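(* Let $L,R,\alpha,\beta$ be positive real constants, let $d$ be a real constant with $0<d<\pi/2$, and let $F\in\mathbf{L}^{\mathrm{DE}}_{L,R,\alpha,\beta}(\mathscr{D}_d)$. Let $\mu=\min\{\alpha,\beta\}$, let $n$ be a positive integer, let $$h=\frac{\operatorname{arsinh}(q(dn/\mu))}{n},$$ and let $M$ and $N$ be defined by $$M=n,\qquad N=\left\lceil\frac{1}{h}\operatorname{arsinh}\left(\frac{\alpha}{\beta}\,q\left(\frac{dn}{\mu}\right)\right)\right\rceil\qquad\text{if }\mu=\alpha,$$ $$N=n,\qquad M=\left\lceil\frac{1}{h}\operatorname{arsinh}\left(\frac{\beta}{\alpha}\,q\left(\frac{dn}{\mu}\right)\right)\right\rceil\qquad\text{if }\mu=\beta$$ (the two cases agree when $\alpha=\beta$). Then $$\sup_{x\in\mathbb{R}}\left|F(x)-\sum_{k=-M}^{N}F(kh)\operatorname{sinc}\left(\frac{x-kh}{h}\right)\right|\le C\,e^{-\pi dn/\operatorname{arsinh}(dn/\mu)},$$ where $C$ is the constant, independent of $n$, given by $$C=\frac{2}{\pi d}\left[\frac{2L\,e^{-\pi\mu(p(d/\mu)-q(d/\mu))}}{\pi\mu\left(1-e^{-2\pi\mu p(d/\mu)}\right)\cos^{\alpha+\beta}\left(\frac{\pi}{2}\sin d\right)\cos d}+\frac{\pi}{2}R\right].$$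
   Context: For $d>0$, $\mathscr{D}_d=\{\zeta\in\mathbb{C}:|\operatorname{Im}\zeta|<d\}$. For positive constants $L,R,\alpha,\beta$ and $0<d<\pi/2$, $\mathbf{L}^{\mathrm{DE}}_{L,R,\alpha,\beta}(\mathscr{D}_d)$ denotes the family of functions $F$ that are analytic in $\mathscr{D}_d$ and satisfy $$|F(\zeta)|\le\frac{L}{|1+e^{-\pi\sinh\zeta}|^{\alpha}\,|1+e^{\pi\sinh\zeta}|^{\beta}}\quad\text{for all }\zeta\in\mathscr{D}_d,$$ $$|F(x)|\le\frac{R}{(1+e^{-\pi\sinh x})^{\alpha}(1+e^{\pi\sinh x})^{\beta}}\quad\text{for all }x\in\mathbb{R}.$$ $\operatorname{sinc}x=\sin(\pi x)/(\pi x)$, with $\operatorname{sinc}0=1$. $\operatorname{arsinh}x=\log(x+\sqrt{1+x^2})$ is the inverse hyperbolic sine. For $x>0$, $$p(x)=\frac{x}{\operatorname{arsinh}(x/\operatorname{arsinh}x)},\qquad q(x)=\frac{x}{\operatorname{arsinh}x}.$$ $\lceil\cdot\rceil$ is the ceiling function. *)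

theory Defs
  imports "HOL-Complex_Analysis.Complex_Analysis"
begin

definition strip :: "real \<Rightarrow> complex set" where
  "strip d = {\<zeta>. \<bar>Im \<zeta>\<bar> < d}"

text \<open>
  For \<open>d < pi / 2\<close> neither \<open>1 + exp (- pi * sinh \<zeta>)\<close> nor \<open>1 + exp (pi * sinh \<zeta>)\<close> vanishes on
  the strip, so the convention \<open>x / 0 = 0\<close> never affects the bounds below.
\<close>
definition LDE :: "real \<Rightarrow> real \<Rightarrow> real \<Rightarrow> real \<Rightarrow> real \<Rightarrow> (complex \<Rightarrow> complex) set" where
  "LDE L R \<alpha> \<beta> d = {F.
     F analytic_on strip d \<and>
     (\<forall>\<zeta>\<in>strip d. norm (F \<zeta>) \<le>
        L / (norm (1 + exp (- complex_of_real pi * sinh \<zeta>)) powr \<alpha> *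
             norm (1 + exp (complex_of_real pi * sinh \<zeta>)) powr \<beta>)) \<and>
     (\<forall>x::real. norm (F (complex_of_real x)) \<le>
        R / ((1 + exp (- pi * sinh x)) powr \<alpha> * (1 + exp (pi * sinh x)) powr \<beta>))}"

text \<open>
  The normalized cardinal sine; \<open>sinc\<close> in \<open>HOL-Probability.Sinc_Integral\<close> is the unnormalized
  one, without the factor \<open>pi\<close>.
\<close>
definition nsinc :: "real \<Rightarrow> real" where
  "nsinc x = (if x = 0 then 1 else sin (pi * x) / (pi * x))"

definition p_fun :: "real \<Rightarrow> real" where
  "p_fun x = x / arsinh (x / arsinh x)"

definition q_fun :: "real \<Rightarrow> real" where
  "q_fun x = x / arsinh x"

definition DE_const :: "real \<Rightarrow> real \<Rightarrow> real \<Rightarrow> real \<Rightarrow> real \<Rightarrow> real" where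
  "DE_const L R \<alpha> \<beta> d = (let \<mu> = min \<alpha> \<beta> in
     2 / (pi * d) *
      (2 * L * exp (- pi * \<mu> * (p_fun (d / \<mu>) - q_fun (d / \<mu>))) /
         (pi * \<mu> * (1 - exp (- 2 * pi * \<mu> * p_fun (d / \<mu>))) *
          cos (pi / 2 * sin d) powr (\<alpha> + \<beta>) * cos d)
       + pi / 2 * R))"

end

theory Submission
  imports Defs
begin

text \<open>
Write \<open>t = d n / \<mu>\<close> and \<open>q = q_fun t\<close>, so that \<open>sinh (n h) = q\<close>. The error splits into the error of the
full cardinal series and the part of that series which the finite sum omits.

The cardinal series is interpolated by a contour integral: for real \<open>x\<close> off the grid the residues
of \<open>F z / ((z - x) sin (\<pi> z / h))\<close> in a rectangle of height \<open>2 a\<close>, \<open>a < d\<close>, add up to the difference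
between \<open>F x\<close> and a symmetric partial sum, divided by \<open>sin (\<pi> x / h)\<close>
(\<open>sinc_rectangle_integral\<close>). On the horizontal sides the integrand is at most
\<open>|F| / (a sinh (\<pi> a / h))\<close>, while the vertical sides are placed midway between two nodes, where the
modulus of the sine is at least 1, and their contribution vanishes as they move out. For the integral of \<open>|F|\<close>
along a horizontal line one needs its decay there. It follows from
\<open>|1 + exp (\<pi> sinh (x + i y))| \<ge> (1 + exp (\<pi> sinh x cos y)) cos ((\<pi> / 2) sin y)\<close>
(\<open>norm_one_plus_exp_pi_sinh\<close>), which reduces the complex weight to the real one up to the constant
\<open>cos ((\<pi> / 2) sin d)\<close>. Since only \<open>F\<close> in the open strip is controlled, the resulting bound is proved
for all \<open>a < d\<close> and \<open>a\<close> tends to \<open>d\<close> at the very end.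

The omitted terms decay like \<open>exp (- \<pi> \<beta> sinh (k h))\<close> on the right and with \<open>\<alpha>\<close> on the left. As
\<open>sinh\<close> lies above its tangents on the positive axis, each tail is dominated by a geometric series.
The choice of \<open>M\<close> and \<open>N\<close> makes the exponential at each cut at most \<open>exp (- \<pi> \<mu> q)\<close>, which is the
claimed rate since \<open>\<mu> q = d n / arsinh t\<close>.

It remains to see that the constants do not depend on \<open>n\<close>. The contour contributes
\<open>1 / sinh (\<pi> d / h)\<close> with \<open>d / h = \<mu> (p_fun t)\<close>, and comparing this with \<open>exp (- \<pi> \<mu> q)\<close> uniformly in \<open>n\<close>
amounts to the monotonicity of \<open>p_fun\<close> and of \<open>p_fun - q_fun\<close> (\<open>p_fun_minus_q_fun_mono\<close>). The tails
carry the factor \<open>2 / (\<pi> \<mu> h cosh (n h))\<close>, which has to be at most \<open>1 / d\<close>; this is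
\<open>cutoff_coth_ge\<close>. Both are inequalities in the single variable \<open>u = arsinh t\<close>.
\<close>

section \<open>Hyperbolic inequalities\<close>

lemma sinh_le_mult_cosh: "sinh x \<le> x * cosh x" if "x \<ge> 0" for x :: real
proof -
  have "0 * cosh 0 - sinh 0 \<le> x * cosh x - sinh x"
  proof (rule DERIV_nonneg_imp_nondecreasing[OF that])
    fix y :: real assume "0 \<le> y"
    moreover have "((\<lambda>y. y * cosh y - sinh y) has_real_derivative y * sinh y) (at y)"
      by (auto intro!: derivative_eq_intros)
    ultimately show "\<exists>D. ((\<lambda>y. y * cosh y - sinh y) has_real_derivative D) (at y) \<and> 0 \<le> D"
      by (intro exI[of _ "y * sinh y"]) auto
  qed
  then show ?thesis by simp
qed

text \<open>
Convexity of \<open>sinh\<close> on the positive axis. It is what makes the omitted terms of the series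
decay at least geometrically.
\<close>

lemma sinh_ge_tangent: "sinh a + (b - a) * cosh a \<le> sinh b" if "0 \<le> a" "a \<le> b" for a b :: real
proof -
  have "sinh a - a * cosh a \<le> sinh b - b * cosh a"
  proof (rule DERIV_nonneg_imp_nondecreasing[OF that(2)])
    fix y :: real assume "a \<le> y" "y \<le> b"
    moreover have "((\<lambda>y. sinh y - y * cosh a) has_real_derivative cosh y - cosh a) (at y)"
      by (auto intro!: derivative_eq_intros)
    ultimately show "\<exists>D. ((\<lambda>y. sinh y - y * cosh a) has_real_derivative D) (at y) \<and> 0 \<le> D"
      using that by (intro exI[of _ "cosh y - cosh a"]) (auto simp: cosh_real_nonneg_le_iff)
  qed
  then show ?thesis by (simp add: algebra_simps)
qed

lemma self_le_sinh: "x \<le> sinh x" if "x \<ge> 0" for x :: real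
  using sinh_ge_tangent[of 0 x] that by simp

lemma one_le_sinh_div: "1 \<le> sinh u / u" if "u > 0" for u :: real
  using self_le_sinh[of u] that by (simp add: field_simps)

lemma sinh_div_mono: "sinh u / u \<le> sinh v / v" if "0 < u" "u \<le> v" for u v :: real
proof (rule DERIV_nonneg_imp_nondecreasing[OF that(2)])
  fix y :: real assume "u \<le> y"
  then have "0 < y" using that by simp
  then have "((\<lambda>y. sinh y / y) has_real_derivative (y * cosh y - sinh y) / y\<^sup>2) (at y)"
    by (auto intro!: derivative_eq_intros simp: power2_eq_square)
  moreover have "0 \<le> (y * cosh y - sinh y) / y\<^sup>2"
    using sinh_le_mult_cosh[of y] \<open>0 < y\<close> by simp
  ultimately show "\<exists>D. ((\<lambda>y. sinh y / y) has_real_derivative D) (at y) \<and> 0 \<le> D" by blast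
qed

lemma exp1_bounds: "2.7182 \<le> exp (1::real)" "exp (1::real) \<le> 2.7183"
  using e_approx_32 unfolding abs_le_iff by (simp_all add: field_simps)

lemma ln_le_div_exp1: "ln u \<le> u / exp 1" if "u > 0" for u :: real
  using ln_add_one_self_le_self2[of "u / exp 1 - 1"] that by (simp add: ln_div)

section \<open>The cutoff as a function of one variable\<close>

text \<open>
With \<open>sinh u = d n / \<mu>\<close> this is \<open>n h\<close>, the abscissa of the last node on the side where the
number of nodes is prescribed to be \<open>n\<close>. In these terms \<open>q_fun (sinh u) = sinh u / u\<close> and \<open>p_fun (sinh u) = sinh u / cutoff u\<close>.
\<close>

definition cutoff :: "real \<Rightarrow> real" where "cutoff u = arsinh (sinh u / u)"

lemma cutoff_pos: "u > 0 \<Longrightarrow> 0 < cutoff u" by (simp add: cutoff_def)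

lemma sinh_cutoff: "sinh (cutoff u) = sinh u / u" by (simp add: cutoff_def)

lemma cutoff_leI: "sinh u / u \<le> sinh a \<Longrightarrow> cutoff u \<le> a"
  using sinh_real_le_iff[of "cutoff u" a] by (simp add: sinh_cutoff)
lemma cutoff_geI: "sinh a \<le> sinh u / u \<Longrightarrow> a \<le> cutoff u"
  using sinh_real_le_iff[of a "cutoff u"] by (simp add: sinh_cutoff)

lemma cutoff_le_self: "cutoff u \<le> u" if "u \<ge> 1"
  using that by (intro cutoff_leI) (auto simp: field_simps mult_le_cancel_left1)

lemma cutoff_le_1: "cutoff u \<le> 1" if "0 < u" "u \<le> 1"
  using sinh_div_mono[of u 1] that by (intro cutoff_leI) auto

text \<open>
Dividing by \<open>u\<close> shifts the dominant part \<open>exp u / 2\<close> of \<open>sinh u\<close> by \<open>ln u\<close>; the discarded exponential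
has the favourable sign because \<open>u\<^sup>2 \<ge> 1\<close>.
\<close>

lemma cutoff_ge_self_minus_ln: "u - ln u \<le> cutoff u" if "u \<ge> 1"
proof (rule cutoff_geI)
  have "sinh (u - ln u) = (exp u / u - u * exp (-u)) / 2"
    using that by (simp add: sinh_field_def exp_diff exp_minus field_simps)
  also have "\<dots> \<le> (exp u / u - exp (-u) / u) / 2"
  proof -
    have "1 \<le> u * u" using mult_mono[of 1 u 1 u] that by simp
    then have "exp (-u) / u \<le> u * exp (-u)" using that by (simp add: field_simps)
    then show ?thesis by argo
  qed
  also have "\<dots> = sinh u / u" using that by (simp add: sinh_field_def field_simps)
  finally show "sinh (u - ln u) \<le> sinh u / u" .
qed

text \<open>
The function \<open>ln u / u\<close> attains its maximum \<open>1 / e\<close> at \<open>u = e\<close>.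
\<close>

lemma cutoff_ge_ratio: "(1 - 1 / exp 1) * u \<le> cutoff u" if "u \<ge> 1"
  using cutoff_ge_self_minus_ln[OF that] ln_le_div_exp1[of u] that
  by (simp add: algebra_simps)

text \<open>
For \<open>u \<ge> 3 > e\<close> the division by \<open>u\<close> costs more than the division by \<open>e\<close> caused by the shift, and the
margin between \<open>1 / 3\<close> and \<open>1 / e\<close> absorbs the decaying exponentials.
\<close>

lemma cutoff_le_self_minus_1: "cutoff u \<le> u - 1" if "u \<ge> 3"
proof (rule cutoff_leI)
  have e: "exp u \<ge> 20"
  proof -
    have "(2.7182::real)^3 \<le> exp 1 ^ 3" by (rule power_mono) (use exp1_bounds in auto)
    also have "\<dots> = exp 3" by (simp add: exp_of_nat_mult[symmetric])
    also have "\<dots> \<le> exp u" using that by simp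
    finally show ?thesis by (simp add: eval_nat_numeral)
  qed
  have "sinh u / u \<le> sinh u / 3" using that by (intro divide_left_mono) auto
  also have "\<dots> = (exp u - exp (-u)) / 6" by (simp add: sinh_field_def)
  also have "\<dots> \<le> exp u / 6" by simp
  also have "\<dots> \<le> (exp u / exp 1 - exp 1 / exp u) / 2"
  proof -
    have a: "exp u / 2.7183 \<le> exp u / exp 1" using exp1_bounds by (intro divide_left_mono) auto
    have b: "exp 1 / exp u \<le> 2.7183 / 20" using exp1_bounds e by (intro frac_le) auto
    have "exp u / 2.7183 \<ge> exp u * 0.367" by simp
    with a b e show ?thesis by simp
  qed
  also have "\<dots> = sinh (u - 1)" by (simp add: sinh_field_def exp_diff exp_minus field_simps)
  finally show "sinh u / u \<le> sinh (u - 1)" .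
qed

lemma exp_minus_double_le: "exp (-2*u) \<le> 1/400" if "u \<ge> 3" for u :: real
proof -
    have "(2.7182::real)^6 \<le> exp 1 ^ 6" by (rule power_mono) (use exp1_bounds in auto)
    also have "\<dots> = exp 6" by (simp add: exp_of_nat_mult[symmetric])
    also have "\<dots> \<le> exp (2*u)" using that by simp
    finally have "400 \<le> exp (2*u)" by (simp add: eval_nat_numeral)
  then show ?thesis by (simp add: exp_minus field_simps)
qed

lemma tanh_eq_exp: "tanh u = (1 - exp (-2*u)) / (1 + exp (-2*u))" for u :: real
  by (simp add: tanh_real_altdef)

lemma tanh_ge_99: "0.99 \<le> tanh u" if "u \<ge> 3" for u :: real
  using exp_minus_double_le[OF that] unfolding tanh_eq_exp 
  by (simp add: pos_le_divide_eq add_pos_pos)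

lemma tanh_le_1: "tanh u \<le> 1" for u :: real
  using tanh_real_bounds[of u] by simp

text \<open>
This is the bound behind the term \<open>(\<pi> / 2) R\<close> of the constant. Writing \<open>A = cutoff u\<close>, it says
\<open>(2 / \<pi>) u \<le> A coth A\<close>. The margin is small: \<open>A / u \<ge> 1 - 1 / e\<close>, about 0.632, does not
reach \<open>2 / \<pi>\<close>, about 0.637, and the factor \<open>coth A\<close> has to supply the rest. It does so for
\<open>u \<le> 4\<close>, where \<open>A\<close> stays bounded; beyond that \<open>ln u / u\<close> is small enough. For \<open>u \<le> 1\<close> the trivial
bound \<open>A coth A \<ge> 1\<close> is enough.
\<close>

lemma cutoff_coth_ge: "2 / pi * u * sinh (cutoff u) \<le> cutoff u * cosh (cutoff u)" if u: "u > 0"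
proof -
  let ?A = "cutoff u"
  have pi: "3.14159 \<le> pi" using pi_approx by simp
  have two: "2 / pi \<le> 0.63663" "2 / pi \<le> 1" using pi by (auto simp: field_simps)
  have Apos: "0 < ?A" using cutoff_pos u by simp
  consider "u \<le> 1" | "1 \<le> u" "u \<le> 4" | "4 \<le> u" by linarith
  then show ?thesis
  proof cases
    case 1
    have "2 / pi * u \<le> 1 * 1" using two u 1 by (intro mult_mono) auto
    then have "2 / pi * u * sinh ?A \<le> 1 * sinh ?A" using Apos by (intro mult_right_mono) auto
    then show ?thesis using sinh_le_mult_cosh[of ?A] Apos by simp
  next
    case 2
    have "sinh ?A \<le> sinh 4 / 4" unfolding sinh_cutoff using 2 u by (intro sinh_div_mono)
    also have "\<dots> \<le> 7"
    proof -
      have "exp (4::real) = exp 1 ^ 4" by (simp add: exp_of_nat_mult[symmetric])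
      also have "\<dots> \<le> 2.7183 ^ 4" using exp1_bounds by (intro power_mono) auto
      finally show ?thesis by (simp add: sinh_field_def eval_nat_numeral) (use exp_gt_zero[of "-4::real"] in linarith)
    qed
    finally have s7: "sinh ?A \<le> 7" .
    have s0: "0 < sinh ?A" using Apos by simp
    have "(1.01 * sinh ?A)\<^sup>2 \<le> (cosh ?A)\<^sup>2"
    proof -
      have "(sinh ?A)\<^sup>2 \<le> 7\<^sup>2" using s7 s0 by (intro power_mono) auto
      moreover have "(1.01 * sinh ?A)\<^sup>2 = 1.0201 * (sinh ?A)\<^sup>2" by (simp add: power2_eq_square)
      ultimately show ?thesis by (simp add: cosh_square_eq)
    qed
    then have c: "1.01 * sinh ?A \<le> cosh ?A" by (rule power2_le_imp_le) simp
    have "1 / exp 1 \<le> (0.3679::real)" using exp1_bounds by (simp add: field_simps)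
    then have "0.6321 * u \<le> (1 - 1 / exp 1) * u" using u by (intro mult_right_mono) auto
    then have a: "0.6321 * u \<le> ?A" using cutoff_ge_ratio[OF 2(1)] by linarith
    have "2 / pi * u * sinh ?A \<le> 0.63663 * u * sinh ?A"
      using two u s0 by (intro mult_right_mono) auto
    also have "\<dots> \<le> (0.6321 * u) * (1.01 * sinh ?A)" using u s0 by simp
    also have "\<dots> \<le> ?A * cosh ?A" using a c u s0 Apos by (intro mult_mono) auto
    finally show ?thesis .
  next
    case 3
    \<comment> \<open>the tangent of the logarithm at 4\<close>
    have "ln u = ln 4 + ln (u / 4)" using u by (simp add: ln_div)
    also have "ln (u / 4) \<le> u / 4 - 1" using ln_le_minus_one[of "u/4"] u by simp
    also have "ln 4 = 2 * ln (2::real)" using ln_realpow[of 2 2] by simp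
    also have "2 * ln (2::real) \<le> 2 * (25/36)" using ln2_le_25_over_36 by simp
    finally have "ln u \<le> u / 4 + 14/36" by simp
    then have a: "0.64 * u \<le> ?A" using cutoff_ge_self_minus_ln[of u] 3 by simp
    have "2 / pi * u \<le> 0.64 * u" using two u by (intro mult_right_mono) auto
    with a have "2 / pi * u \<le> ?A" by simp
    then show ?thesis using Apos sinh_le_cosh_real[of ?A] by (intro mult_mono) auto
  qed
qed

section \<open>Monotonicity of \<open>p - q\<close>\<close>

text \<open>
Up to the positive factor \<open>cosh u / (cutoff u)\<^sup>2\<close> the expression is the derivative of
\<open>sinh u / cutoff u - sinh u / u\<close>, written with \<open>sinh u / u = cosh u (tanh u / u)\<close>. Put \<open>A = cutoff u\<close>,
\<open>r = A / u \<le> 1\<close> and \<open>T = tanh A\<close>. For \<open>u \<le> 3\<close> replacing \<open>A\<close> and \<open>tanh u\<close> by the smaller \<open>T\<close> leaves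
\<open>T (r\<^sup>2 - r + tanh u / u)\<close>, which is nonnegative because \<open>r\<^sup>2 - r \<ge> -1/4\<close> and \<open>tanh u / u \<ge> 1/4\<close>. For
\<open>u \<ge> 3\<close> the gap \<open>u - A\<close> is at least 1, so that \<open>A (1 - r) = r (u - A) \<ge> r\<close>; as \<open>r\<close> is at least 0.63,
\<open>r + r\<^sup>2 tanh u\<close> exceeds 1 and so compensates the only negative term.
\<close>

lemma pq_diff_derivative_nonneg_ge_1:
  assumes u: "u \<ge> 1"
  shows "0 \<le> cutoff u * (1 - cutoff u / u) - tanh (cutoff u) * (1 - tanh u / u) + (cutoff u / u)\<^sup>2 * tanh u"
proof -
  let ?A = "cutoff u" let ?T = "tanh ?A" let ?r = "?A / u"
  have Apos: "0 < ?A" using cutoff_pos u by simp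
  have Au: "?A \<le> u" by (rule cutoff_le_self[OF u])
  have T0: "0 < ?T" using Apos by simp
  have Tu: "?T \<le> tanh u" using Au by (simp add: strict_mono_less_eq[OF tanh_real_strict_mono])
  have r: "0 < ?r" "?r \<le> 1" using Apos Au u by auto
  have T1: "?T \<le> 1" "tanh u \<le> 1" by (rule tanh_le_1)+
  have TA: "?T \<le> ?A" using sinh_le_mult_cosh[of ?A] Apos by (simp add: tanh_def field_simps)
  show ?thesis
  proof (cases "u \<le> 3")
    case True
    have "tanh u / u \<ge> 1/4"
    proof -
      have "tanh 3 / 3 \<le> tanh u / u"
      proof (rule DERIV_nonpos_imp_nonincreasing[of u 3 "\<lambda>u. tanh u / u"])
        fix y assume "u \<le> y"
        then have y: "y > 0" using u by simp
        have "((\<lambda>u. tanh u / u) has_real_derivative (y * (1 - tanh y ^ 2) - tanh y) / y\<^sup>2) (at y)"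
          using y by (auto intro!: derivative_eq_intros simp: power2_eq_square)
        moreover have "y * (1 - tanh y ^ 2) - tanh y \<le> 0"
        proof -
          have "1 - tanh y ^ 2 = (cosh y ^ 2 - sinh y ^ 2) / cosh y ^ 2"
            by (simp add: tanh_def power_divide diff_divide_distrib)
          then have "1 - tanh y ^ 2 = 1 / cosh y ^ 2" by (simp add: cosh_square_eq)
          moreover have "y \<le> sinh y * cosh y"
            using self_le_sinh[of y] cosh_real_ge_1[of y] y mult_mono[of y "sinh y" 1 "cosh y"] by simp
          moreover have "y * (1 / cosh y ^ 2) - tanh y = (y - sinh y * cosh y) / cosh y ^ 2"
            by (simp add: tanh_def diff_divide_distrib power2_eq_square)
          ultimately show ?thesis by (simp add: divide_nonpos_pos)
        qed
        ultimately show "\<exists>D. ((\<lambda>u. tanh u / u) has_real_derivative D) (at y) \<and> D \<le> 0"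
          by (meson divide_nonpos_nonneg zero_le_power2)
      qed (use True in auto)
      then show ?thesis using tanh_ge_99[of 3] by simp
    qed
    moreover have "0 \<le> r\<^sup>2 - r + 1/4" for r :: real
      using zero_le_power2[of "r - 1/2"] by (simp add: power2_eq_square algebra_simps)
    ultimately have "0 \<le> ?r\<^sup>2 - ?r + tanh u / u" by (smt (verit))
    then have "0 \<le> ?T * (?r\<^sup>2 - ?r + tanh u / u)" using T0 by (intro mult_nonneg_nonneg) auto
    also have "\<dots> = ?T * (1 - ?r) - ?T * (1 - tanh u / u) + ?r\<^sup>2 * ?T" by (simp add: algebra_simps)
    also have "\<dots> \<le> ?A * (1 - ?r) - ?T * (1 - tanh u / u) + ?r\<^sup>2 * tanh u"
      using TA Tu r T1 u by (intro add_mono diff_mono mult_right_mono mult_left_mono) auto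
    finally show ?thesis .
  next
    case False
    then have u3: "u \<ge> 3" by simp
    have "1 / exp 1 \<le> (0.37::real)" using exp1_bounds by (simp add: field_simps)
    then have "0.63 * u \<le> (1 - 1 / exp 1) * u" using u by (intro mult_right_mono) auto
    then have "0.63 * u \<le> ?A" using cutoff_ge_ratio[OF u] by linarith
    then have r63: "0.63 \<le> ?r" using u by (simp add: le_divide_eq)
    have "?A * (1 - ?r) = ?r * (u - ?A)" using u by (simp add: field_simps)
    moreover have "?r * 1 \<le> ?r * (u - ?A)" using cutoff_le_self_minus_1[OF u3] r by (intro mult_left_mono) auto
    ultimately have 1: "0.63 \<le> ?A * (1 - ?r)" using r63 by linarith
    have "0.63\<^sup>2 * 0.99 \<le> ?r\<^sup>2 * tanh u" using r63 tanh_ge_99[OF u3] by (intro mult_mono power_mono) auto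
    moreover have "(0.38::real) \<le> 0.63\<^sup>2 * 0.99" by (simp add: power2_eq_square)
    ultimately have 2: "0.38 \<le> ?r\<^sup>2 * tanh u" by linarith
    have "?T * (1 - tanh u / u) \<le> 1 * 1" using T0 T1 u by (intro mult_mono) (auto simp: field_simps)
    moreover have "0 \<le> a - b + c" if "b \<le> 1 * 1" "0.63 \<le> a" "0.38 \<le> c" for a b c :: real
      using that by simp
    ultimately show ?thesis using 1 2 by blast
  qed
qed

lemma cosh_minus_sinh_div_le: "cosh u - sinh u / u \<le> u" if "0 < u" "u \<le> 1" for u :: real
proof -
  have "exp u \<le> 1 + u + u\<^sup>2" using that by (intro exp_bound) auto
  moreover have "exp (-u) \<le> 1" using that by simp
  moreover have "u\<^sup>2 \<le> u" using that by (simp add: power2_eq_square mult_le_cancel_right1)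
  ultimately have "exp u + exp (- u) \<le> 2 + u * 2" using that by linarith
  then have "cosh u \<le> 1 + u" by (simp add: cosh_field_def)
  then show ?thesis using one_le_sinh_div[of u] that by linarith
qed

text \<open>
The derivative of \<open>p_fun (sinh u) - q_fun (sinh u)\<close>. For \<open>u \<le> 1\<close> one has \<open>A \<le> 1 \<le> q\<close>, and \<open>tanh A \<le> A\<close>
cancels the terms with \<open>cosh u\<close>: what is left is at least \<open>q / A - (cosh u - q) / u\<close>, a number that is
at least 1 minus one that is at most 1. This is too crude for larger \<open>u\<close>, which
the previous lemma covers.
\<close>

lemma pq_diff_derivative_nonneg:
  assumes u: "u > 0"
  defines "q \<equiv> sinh u / u" and "A \<equiv> cutoff u"
  shows "0 \<le> cosh u / A - (cosh u - q) * tanh A / A\<^sup>2 - (cosh u - q) / u"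
proof (cases "u \<le> 1")
  case True
  have A: "0 < A" "A \<le> 1" using cutoff_pos cutoff_le_1 u True unfolding A_def by auto
  have q1: "1 \<le> q" unfolding q_def by (rule one_le_sinh_div[OF u])
  have nn: "0 \<le> cosh u - q" unfolding q_def using sinh_le_mult_cosh[of u] u by (simp add: field_simps)
  have "tanh A \<le> A" using sinh_le_mult_cosh[of A] A by (simp add: tanh_def field_simps)
  then have "(cosh u - q) * tanh A / A\<^sup>2 \<le> (cosh u - q) * A / A\<^sup>2"
    using nn by (intro divide_right_mono mult_left_mono) auto
  also have "\<dots> = cosh u / A - q / A" using A by (simp add: field_simps power2_eq_square)
  finally have 1: "q / A \<le> cosh u / A - (cosh u - q) * tanh A / A\<^sup>2" by simp
  have "(cosh u - q) / u \<le> 1" using cosh_minus_sinh_div_le[OF u True] u by (simp add: q_def)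
  also have "1 \<le> q / A" using A q1 by simp
  finally show ?thesis using 1 by simp
next
  case False
  then have u1: "u \<ge> 1" by simp
  have A: "0 < A" using cutoff_pos u unfolding A_def by auto
  have q: "q = cosh u * (tanh u / u)" by (simp add: q_def tanh_def)
  have "cosh u / A - (cosh u - q) * tanh A / A\<^sup>2 - (cosh u - q) / u
      = cosh u / A\<^sup>2 * (A * (1 - A / u) - tanh A * (1 - tanh u / u) + (A / u)\<^sup>2 * tanh u)"
    unfolding q using A u by (simp add: field_simps power2_eq_square)
  also have "\<dots> \<ge> 0" using pq_diff_derivative_nonneg_ge_1[OF u1] unfolding A_def by (intro mult_nonneg_nonneg) auto
  finally show ?thesis .
qed

lemma pq_diff_mono:
  assumes "0 < u" "u \<le> v"
  shows "sinh u / cutoff u - sinh u / u \<le> sinh v / cutoff v - sinh v / v"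
proof (rule DERIV_nonneg_imp_nondecreasing[OF assms(2)])
  fix y assume "u \<le> y"
  then have y: "y > 0" using assms by simp
  let ?q = "sinh y / y" let ?A = "cutoff y"
  let ?q' = "(cosh y - ?q) / y"
  have A: "0 < ?A" using cutoff_pos y by auto
  have dq: "((\<lambda>y. sinh y / y) has_real_derivative ?q') (at y)"
    using y by (auto intro!: derivative_eq_intros simp: field_simps)
  have dA: "(cutoff has_real_derivative ?q' / cosh ?A) (at y)"
    unfolding cutoff_def[abs_def] cosh_arsinh_real
    using DERIV_chain2[OF arsinh_real_has_field_derivative dq] by (simp add: mult.commute)
  have "((\<lambda>y. sinh y / cutoff y - sinh y / y) has_real_derivative
     (cosh y * ?A - sinh y * (?q' / cosh ?A)) / (?A * ?A) - ?q') (at y)"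
    using A by (intro DERIV_diff DERIV_divide dq dA) (auto intro!: derivative_eq_intros)
  also have "(cosh y * ?A - sinh y * (?q' / cosh ?A)) / (?A * ?A) - ?q' =
      cosh y / ?A - (cosh y - ?q) * tanh ?A / ?A\<^sup>2 - (cosh y - ?q) / y"
  proof -
    have "sinh y * (?q' / cosh ?A) = (cosh y - ?q) * tanh ?A"
      using y by (simp add: tanh_def sinh_cutoff)
    then show ?thesis using A by (simp add: diff_divide_distrib power2_eq_square)
  qed
  finally show "\<exists>D. ((\<lambda>y. sinh y / cutoff y - sinh y / y) has_real_derivative D) (at y) \<and> 0 \<le> D"
    using pq_diff_derivative_nonneg[OF y] by blast
qed


section \<open>The double exponential weight on the strip\<close>

lemma mult_cos_le_sin: "x * cos x \<le> sin x" if "0 \<le> x" "x \<le> pi" for x :: real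
proof -
  have "x * cos x - sin x \<le> 0 * cos 0 - sin 0"
  proof (rule DERIV_nonpos_imp_nonincreasing[OF that(1)])
    fix y :: real assume "0 \<le> y" "y \<le> x"
    moreover have "((\<lambda>y. y * cos y - sin y) has_real_derivative - (y * sin y)) (at y)"
      by (auto intro!: derivative_eq_intros)
    moreover have "sin y \<ge> 0" using calculation that by (intro sin_ge_zero) auto
    ultimately show "\<exists>D. ((\<lambda>y. y * cos y - sin y) has_real_derivative D) (at y) \<and> D \<le> 0"
      by (intro exI[of _ "- (y * sin y)"]) auto
  qed
  then show ?thesis by simp
qed

lemma sin_div_antimono: "sin y / y \<le> sin x / x" if "0 < x" "x \<le> y" "y \<le> pi" for x y :: real
proof (rule DERIV_nonpos_imp_nonincreasing[OF that(2)])
  fix t :: real assume "x \<le> t" "t \<le> y"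
  then have t: "0 < t" "t \<le> pi" using that by auto
  then have "((\<lambda>t. sin t / t) has_real_derivative (t * cos t - sin t) / t\<^sup>2) (at t)"
    by (auto intro!: derivative_eq_intros simp: power2_eq_square)
  moreover have "(t * cos t - sin t) / t\<^sup>2 \<le> 0"
    using mult_cos_le_sin[of t] t by (intro divide_nonpos_nonneg) auto
  ultimately show "\<exists>D. ((\<lambda>t. sin t / t) has_real_derivative D) (at t) \<and> D \<le> 0" by blast
qed

text \<open>
This is \<open>c cot c \<le> \<pi>\<^sup>2 / 4 - c\<^sup>2\<close>. Both sides vanish at \<open>\<pi> / 2\<close>, so the factor \<open>\<pi> / 2 - c\<close> has to be
split off exactly: it bounds \<open>cos c\<close> from above, and \<open>sin c \<ge> 2 c / \<pi>\<close> handles what remains.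
\<close>

lemma mult_cos_le_quadratic_sin:
  assumes "0 \<le> c" "c \<le> pi / 2"
  shows "c * cos c \<le> (pi\<^sup>2 / 4 - c\<^sup>2) * sin c"
proof (cases "c = 0")
  case False
  then have c: "0 < c" using assms by simp
  have "cos c = sin (pi / 2 - c)" by (simp add: cos_sin_eq)
  also have "\<dots> \<le> pi / 2 - c" using assms by (intro sin_x_le_x) auto
  finally have "c * cos c \<le> c * (pi / 2 - c)" using c by (intro mult_left_mono) auto
  also have "\<dots> \<le> c * (pi / 2 - c) * (1 + 2 * c / pi)"
    using c assms mult_left_mono[of 1 "1 + 2 * c / pi" "c * (pi / 2 - c)"] by simp
  also have "\<dots> = (pi\<^sup>2 / 4 - c\<^sup>2) * (2 / pi * c)"
    by (simp add: field_simps power2_eq_square)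
  also have "\<dots> \<le> (pi\<^sup>2 / 4 - c\<^sup>2) * sin c"
  proof (rule mult_left_mono)
    show "2 / pi * c \<le> sin c" using sin_div_antimono[of c "pi/2"] c assms by (simp add: field_simps)
    have "c\<^sup>2 \<le> (pi / 2)\<^sup>2" using assms by (intro power_mono) auto
    then show "0 \<le> pi\<^sup>2 / 4 - c\<^sup>2" by (simp add: power_divide)
  qed
  finally show ?thesis .
qed auto

text \<open>
As a function of \<open>v\<^sup>2\<close>, \<open>sin\<^sup>2 v\<close> is concave on this range and lies below its tangent at \<open>c\<^sup>2\<close>. The
factorisation \<open>sin (v - c) sin (v + c)\<close> shows this without second derivatives.
\<close>

lemma sin_sq_diff_le:
  assumes "0 < c" "c \<le> v" "v \<le> pi / 2"
  shows "(sin v)\<^sup>2 - (sin c)\<^sup>2 \<le> (v\<^sup>2 - c\<^sup>2) * (sin (2 * c) / (2 * c))"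
proof -
  have "(sin v)\<^sup>2 - (sin c)\<^sup>2 = sin (v - c) * sin (v + c)"
    using sin_cos_squared_add[of v] sin_cos_squared_add[of c]
    unfolding sin_add sin_diff by algebra
  also have "\<dots> \<le> (v - c) * sin (v + c)"
    using assms by (intro mult_right_mono sin_x_le_x sin_ge_zero) auto
  also have "\<dots> \<le> (v - c) * ((v + c) * (sin (2 * c) / (2 * c)))"
  proof (rule mult_left_mono)
    have "sin (v + c) / (v + c) \<le> sin (2 * c) / (2 * c)"
      using assms by (intro sin_div_antimono) auto
    then show "sin (v + c) \<le> (v + c) * (sin (2 * c) / (2 * c))"
      using assms by (simp add: divide_le_eq mult.commute)
  qed (use assms in auto)
  also have "\<dots> = (v\<^sup>2 - c\<^sup>2) * (sin (2 * c) / (2 * c))"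
    by (simp add: power2_eq_square algebra_simps)
  finally show ?thesis .
qed

text \<open>
The right-hand side is affine in \<open>v\<^sup>2\<close> for \<open>v = c k\<close> and agrees with \<open>sin\<^sup>2 v\<close> at \<open>v = c\<close>. As long as
\<open>v \<le> \<pi> / 2\<close> concavity (\<open>sin_sq_diff_le\<close>) leaves only the slopes at \<open>v = c\<close> to compare, which is
\<open>mult_cos_le_quadratic_sin\<close>. At \<open>v = \<pi> / 2\<close> the right-hand side has reached 1, and it only grows
afterwards.
\<close>

lemma sin_sq_scaled_le:
  assumes c: "0 \<le> c" "c \<le> pi / 2" and k: "1 \<le> k"
  shows "(sin (c * k))\<^sup>2 \<le> (sin c)\<^sup>2 * (1 + (k\<^sup>2 - 1) * (pi\<^sup>2 / 4 - c\<^sup>2))"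
proof (cases "c = 0")
  case False
  then have c0: "0 < c" using c by simp
  have below: "(sin v)\<^sup>2 \<le> (sin c)\<^sup>2 * (1 + (v\<^sup>2 / c\<^sup>2 - 1) * (pi\<^sup>2 / 4 - c\<^sup>2))"
    if v: "c \<le> v" "v \<le> pi / 2" for v
  proof -
    have s: "0 \<le> sin c" using c by (intro sin_ge_zero) auto
    have "c\<^sup>2 \<le> v\<^sup>2" using v c by (intro power_mono) auto
    have "(sin v)\<^sup>2 \<le> (sin c)\<^sup>2 + (v\<^sup>2 - c\<^sup>2) * (sin (2 * c) / (2 * c))"
      using sin_sq_diff_le[OF c0 v] by simp
    also have "sin (2 * c) / (2 * c) = sin c * (c * cos c) / c\<^sup>2"
      using c0 by (simp add: sin_double power2_eq_square)
    also have "\<dots> \<le> sin c * ((pi\<^sup>2 / 4 - c\<^sup>2) * sin c) / c\<^sup>2"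
      using mult_cos_le_quadratic_sin[OF c] s by (intro divide_right_mono mult_left_mono) auto
    also have "(sin c)\<^sup>2 + (v\<^sup>2 - c\<^sup>2) * (sin c * ((pi\<^sup>2 / 4 - c\<^sup>2) * sin c) / c\<^sup>2) =
      (sin c)\<^sup>2 * (1 + (v\<^sup>2 / c\<^sup>2 - 1) * (pi\<^sup>2 / 4 - c\<^sup>2))"
      using c0 by (simp add: field_simps power2_eq_square)
    finally show ?thesis using \<open>c\<^sup>2 \<le> v\<^sup>2\<close> by (simp add: mult_left_mono)
  qed
  show ?thesis
  proof (cases "c * k \<le> pi / 2")
    case True
    have "c \<le> c * k" using mult_left_mono[OF k, of c] c by simp
    then show ?thesis using below[OF _ True] c0 by (simp add: power_mult_distrib)
  next
    case False
    have q: "0 \<le> pi\<^sup>2 / 4 - c\<^sup>2"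
      using power_mono[of c "pi/2" 2] c by (simp add: power_divide)
    have "(pi / 2)\<^sup>2 \<le> (c * k)\<^sup>2" using False by (intro power_mono) auto
    then have "(pi / 2)\<^sup>2 / c\<^sup>2 \<le> k\<^sup>2" using c0 by (simp add: power_mult_distrib field_simps)
    have "(sin (c * k))\<^sup>2 \<le> 1" by (simp add: sin_squared_eq)
    also have "1 \<le> (sin c)\<^sup>2 * (1 + ((pi / 2)\<^sup>2 / c\<^sup>2 - 1) * (pi\<^sup>2 / 4 - c\<^sup>2))"
      using below[of "pi / 2"] c by simp
    also have "\<dots> \<le> (sin c)\<^sup>2 * (1 + (k\<^sup>2 - 1) * (pi\<^sup>2 / 4 - c\<^sup>2))"
      using \<open>(pi / 2)\<^sup>2 / c\<^sup>2 \<le> k\<^sup>2\<close> q by (intro mult_left_mono add_left_mono mult_right_mono) auto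
    finally show ?thesis .
  qed
qed auto

lemma Re_sinh_Complex: "Re (sinh (Complex x y)) = sinh x * cos y"
  by (simp add: sinh_field_def Re_exp field_simps)

lemma Im_sinh_Complex: "Im (sinh (Complex x y)) = cosh x * sin y"
  by (simp add: sinh_field_def cosh_field_def Im_exp field_simps)

text \<open>
With \<open>s + i t = \<pi> sinh (x + i y)\<close> and \<open>c = (\<pi> / 2) |sin y|\<close> the squared modulus is
\<open>(1 + exp s)\<^sup>2 - 4 exp s sin\<^sup>2 (t / 2)\<close>, and \<open>(1 + exp s)\<^sup>2 = 4 exp s cosh\<^sup>2 (s / 2)\<close>. The claim thus
becomes \<open>sin\<^sup>2 (t / 2) \<le> sin\<^sup>2 c cosh\<^sup>2 (s / 2)\<close>. Here \<open>t / 2 = \<plusminus> c cosh x\<close>, and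
\<open>cosh\<^sup>2 (s / 2) \<ge> 1 + (s / 2)\<^sup>2 = 1 + (cosh\<^sup>2 x - 1) (\<pi>\<^sup>2 / 4 - c\<^sup>2)\<close>, so that the trigonometric
inequality above applies with \<open>k = cosh x\<close>.
\<close>

lemma norm_one_plus_exp_pi_sinh:
  assumes "\<bar>y\<bar> \<le> pi / 2"
  shows "(1 + exp (pi * sinh x * cos y)) * cos (pi / 2 * sin y)
    \<le> norm (1 + exp (complex_of_real pi * sinh (Complex x y)))"
proof (rule power2_le_imp_le)
  define s t c where "s = pi * sinh x * cos y" and "t = pi * cosh x * sin y"
    and "c = pi / 2 * \<bar>sin y\<bar>"
  have c: "0 \<le> c" "c \<le> pi / 2"
    by (auto simp: c_def mult_left_le)
  have "(sin (t / 2))\<^sup>2 = (sin (c * cosh x))\<^sup>2"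
    by (auto simp: t_def c_def abs_if mult_ac)
  also have "\<dots> \<le> (sin c)\<^sup>2 * (1 + ((cosh x)\<^sup>2 - 1) * (pi\<^sup>2 / 4 - c\<^sup>2))"
    by (rule sin_sq_scaled_le[OF c cosh_real_ge_1])
  also have "((cosh x)\<^sup>2 - 1) * (pi\<^sup>2 / 4 - c\<^sup>2) = (s / 2)\<^sup>2"
    by (simp add: cosh_square_eq s_def c_def cos_squared_eq power_mult_distrib power_divide algebra_simps)
  also have "(s / 2)\<^sup>2 \<le> (sinh (s / 2))\<^sup>2"
  proof -
    have "\<bar>s / 2\<bar> \<le> \<bar>sinh (s / 2)\<bar>" using self_le_sinh[of "\<bar>s / 2\<bar>"] unfolding sinh_real_abs by simp
    then show ?thesis by (simp only: abs_le_square_iff)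
  qed
  also have "1 + (sinh (s / 2))\<^sup>2 = (cosh (s / 2))\<^sup>2" by (simp add: cosh_square_eq)
  finally have key: "(sin (t / 2))\<^sup>2 \<le> (sin c)\<^sup>2 * (cosh (s / 2))\<^sup>2"
    by (simp add: mult_left_mono)
  have exps: "4 * exp s * (cosh (s / 2))\<^sup>2 = (1 + exp s)\<^sup>2"
  proof -
    have "2 * exp (s / 2) * cosh (s / 2) = 1 + exp s"
      by (simp add: cosh_field_def algebra_simps flip: exp_add)
    then have "(2 * exp (s / 2) * cosh (s / 2))\<^sup>2 = (1 + exp s)\<^sup>2" by simp
    then show ?thesis by (simp add: power_mult_distrib flip: exp_double)
  qed
  have "((1 + exp s) * cos (pi / 2 * sin y))\<^sup>2 = (1 + exp s)\<^sup>2 * (1 - (sin c)\<^sup>2)"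
    by (auto simp: power_mult_distrib c_def abs_if cos_squared_eq)
  also have "\<dots> = (1 + exp s)\<^sup>2 - 4 * exp s * ((sin c)\<^sup>2 * (cosh (s / 2))\<^sup>2)"
    unfolding exps[symmetric] by (simp add: algebra_simps)
  also have "\<dots> \<le> (1 + exp s)\<^sup>2 - 4 * exp s * (sin (t / 2))\<^sup>2"
    using key by (intro diff_left_mono mult_left_mono) auto
  also have "4 * exp s * (sin (t / 2))\<^sup>2 = 2 * exp s * (1 - cos t)"
    using cos_double_sin[of "t / 2"] by simp
  also have "(1 + exp s)\<^sup>2 - 2 * exp s * (1 - cos t) = (1 + exp s * cos t)\<^sup>2 + (exp s * sin t)\<^sup>2"
    using sin_cos_squared_add[of t] by algebra
  also have "\<dots> = (norm (1 + exp (complex_of_real pi * sinh (Complex x y))))\<^sup>2"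
    by (simp add: cmod_power2 Re_exp Im_exp Re_sinh_Complex Im_sinh_Complex s_def t_def mult.assoc)
  finally show "((1 + exp (pi * sinh x * cos y)) * cos (pi / 2 * sin y))\<^sup>2 \<le> \<dots>"
    by (simp add: s_def)
qed simp

lemma norm_one_plus_exp_neg_pi_sinh:
  assumes "\<bar>y\<bar> \<le> pi / 2"
  shows "(1 + exp (- (pi * sinh x * cos y))) * cos (pi / 2 * sin y)
    \<le> norm (1 + exp (- complex_of_real pi * sinh (Complex x y)))"
proof -
  have "Complex (-x) (-y) = - Complex x y" by (simp add: complex_eq_iff)
  then show ?thesis using norm_one_plus_exp_pi_sinh[of "-y" "-x"] assms by simp
qed

lemma one_plus_exp_powr_ge:
  fixes \<gamma> t :: real
  assumes "\<gamma> > 0"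
  shows "1 \<le> (1 + exp t) powr \<gamma>" "exp (\<gamma> * t) \<le> (1 + exp t) powr \<gamma>"
proof -
  show "1 \<le> (1 + exp t) powr \<gamma>" using assms by (intro ge_one_powr_ge_zero) auto
  have "exp (\<gamma> * t) = exp t powr \<gamma>" by (simp add: powr_def)
  also have "\<dots> \<le> (1 + exp t) powr \<gamma>" using assms by (intro powr_mono2) auto
  finally show "exp (\<gamma> * t) \<le> (1 + exp t) powr \<gamma>" .
qed

text \<open>
Replacing both exponents by their minimum is the source of the symmetric factor \<open>2 / (\<pi> \<mu> cos d)\<close> in
the constant; it makes the majorant an even function of \<open>s\<close>.
\<close>

lemma DE_weight_le:
  fixes \<alpha> \<beta> s :: real
  assumes "\<alpha> > 0" "\<beta> > 0"
  shows "(1 + exp (-s)) powr \<alpha> * (1 + exp s) powr \<beta> \<ge> exp (min \<alpha> \<beta> * \<bar>s\<bar>)"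
proof -
  note 1 = one_plus_exp_powr_ge
  show ?thesis
  proof (cases "s \<ge> 0")
    case True
    have "exp (min \<alpha> \<beta> * \<bar>s\<bar>) \<le> 1 * exp (\<beta> * s)" using True by (simp add: mult_right_mono)
    also have "\<dots> \<le> (1 + exp (-s)) powr \<alpha> * (1 + exp s) powr \<beta>"
      using assms by (intro mult_mono 1) auto
    finally show ?thesis .
  next
    case False
    have "exp (min \<alpha> \<beta> * \<bar>s\<bar>) \<le> exp (\<alpha> * (-s)) * 1" using False by (simp add: mult_right_mono)
    also have "\<dots> \<le> (1 + exp (-s)) powr \<alpha> * (1 + exp s) powr \<beta>"
      using assms by (intro mult_mono 1) auto
    finally show ?thesis .
  qed
qed

text \<open>
A majorant that is uniform in \<open>|y| \<le> a\<close>: both \<open>cos y\<close> and \<open>cos ((\<pi> / 2) sin y)\<close> are smallest at \<open>|y| = a\<close>.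
It is used on the horizontal sides of the contour and, where only boundedness matters, on the
vertical ones.
\<close>

lemma LDE_bound_strip:
  assumes F: "F \<in> LDE L R \<alpha> \<beta> d" and pos: "L > 0" "\<alpha> > 0" "\<beta> > 0"
    and a: "0 < a" "a < d" "d < pi / 2" and y: "\<bar>y\<bar> \<le> a"
  shows "norm (F (Complex x y)) \<le> L / cos (pi / 2 * sin a) powr (\<alpha> + \<beta>) *
     exp (- (pi * min \<alpha> \<beta> * cos a) * \<bar>sinh x\<bar>)"
proof -
  define s where "s = pi * sinh x * cos y"
  define C where "C = cos (pi / 2 * sin a)"
  have sa: "0 \<le> sin a" "sin a < 1"
    using a sin_monotone_2pi[of a "pi/2"] by (auto intro!: sin_ge_zero)
  have C: "0 < C" unfolding C_def
    by (intro cos_gt_zero_pi) (use sa in \<open>auto intro: order.strict_trans2[of _ 0]\<close>)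
  have cy: "cos a \<le> cos y" "0 < cos a"
    using a y cos_monotone_0_pi_le[of "\<bar>y\<bar>" a] cos_gt_zero_pi[of a] by auto
  have "\<bar>sin y\<bar> \<le> sin a"
    using sin_monotone_2pi_le[of "y" a] sin_monotone_2pi_le[of "-a" y] a y by (auto simp: abs_le_iff)
  then have "C \<le> cos \<bar>pi / 2 * sin y\<bar>" unfolding C_def using sa
    by (intro cos_monotone_0_pi_le) (auto simp: abs_mult mult_left_le)
  then have Cy: "C \<le> cos (pi / 2 * sin y)" unfolding cos_abs_real .
  have E: "(1 + exp t) * C \<le> (1 + exp t) * cos (pi / 2 * sin y)" for t :: real
    using Cy by (intro mult_left_mono) (auto intro: add_nonneg_nonneg)
  have n1: "(1 + exp (-s)) * C \<le> norm (1 + exp (- complex_of_real pi * sinh (Complex x y)))"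
    using norm_one_plus_exp_neg_pi_sinh[of y x] E[of "-s"] a y unfolding s_def by linarith
  have n2: "(1 + exp s) * C \<le> norm (1 + exp (complex_of_real pi * sinh (Complex x y)))"
    using norm_one_plus_exp_pi_sinh[of y x] E[of "s"] a y unfolding s_def by linarith
  have "pi * min \<alpha> \<beta> * cos a * \<bar>sinh x\<bar> \<le> pi * min \<alpha> \<beta> * cos y * \<bar>sinh x\<bar>"
    using cy pos by (intro mult_right_mono mult_left_mono) auto
  also have "\<dots> = min \<alpha> \<beta> * \<bar>s\<bar>" using cy by (simp add: s_def abs_mult)
  finally have "C powr (\<alpha> + \<beta>) * exp (pi * min \<alpha> \<beta> * cos a * \<bar>sinh x\<bar>) \<le>
      C powr (\<alpha> + \<beta>) * ((1 + exp (-s)) powr \<alpha> * (1 + exp s) powr \<beta>)"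
    using DE_weight_le[OF pos(2,3), of s] by (intro mult_left_mono order.trans[OF _ DE_weight_le]) (auto simp: pos)
  also have "\<dots> = ((1 + exp (-s)) * C) powr \<alpha> * ((1 + exp s) * C) powr \<beta>"
    using C by (simp add: powr_mult powr_add add_nonneg_nonneg)
  also have "\<dots> \<le> norm (1 + exp (- complex_of_real pi * sinh (Complex x y))) powr \<alpha> *
       norm (1 + exp (complex_of_real pi * sinh (Complex x y))) powr \<beta>" (is "_ \<le> ?D")
    using n1 n2 C pos by (intro mult_mono powr_mono2 mult_nonneg_nonneg) (auto intro: add_nonneg_nonneg)
  finally have D: "C powr (\<alpha> + \<beta>) * exp (pi * min \<alpha> \<beta> * cos a * \<bar>sinh x\<bar>) \<le> ?D" .
  have D0: "0 < C powr (\<alpha> + \<beta>) * exp (pi * min \<alpha> \<beta> * cos a * \<bar>sinh x\<bar>)" using C by simp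
  have "Complex x y \<in> strip d" using a y by (auto simp: strip_def)
  then have "norm (F (Complex x y)) \<le> L / ?D" using F unfolding LDE_def by blast
  also have "\<dots> \<le> L / (C powr (\<alpha> + \<beta>) * exp (pi * min \<alpha> \<beta> * cos a * \<bar>sinh x\<bar>))"
    by (rule divide_left_mono[OF D]) (use pos D0 order.strict_trans2[OF D0 D] in \<open>auto intro!: mult_pos_pos simp del: powr_gt_zero\<close>)
  finally show ?thesis unfolding C_def by (simp add: exp_minus field_simps)
qed

section \<open>Cardinal interpolation by residues\<close>

text \<open>
The numerator is allowed to vanish at \<open>z\<close>, in which case there is no pole; the formula then follows
by linearity from the numerators \<open>f + 1\<close> and \<open>1\<close>. This matters below because \<open>F\<close> may vanish at some
of the nodes.
\<close>

lemma residue_divide_simple_zero: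
  assumes f: "f holomorphic_on s" and g: "g holomorphic_on s" and s: "open s" "z \<in> s"
    and nz: "\<And>w. w \<in> s \<Longrightarrow> w \<noteq> z \<Longrightarrow> g w \<noteq> 0"
    and g': "(g has_field_derivative g') (at z)" "g z = 0" "g' \<noteq> 0"
  shows "residue (\<lambda>w. f w / g w) z = f z / g'"
proof -
  obtain e where e: "e > 0" "ball z e \<subseteq> s" using s openE by blast
  have res: "residue (\<lambda>w. k w / g w) z = k z / g'" if "k holomorphic_on s" "k z \<noteq> 0" for k
    by (rule residue_simple_pole_deriv[of k "ball z e"])
      (use that e g g' in \<open>auto intro: holomorphic_on_subset\<close>)
  show ?thesis
  proof (cases "f z = 0")
    case True
    have "residue (\<lambda>w. (f w + 1) / g w - 1 / g w) z
        = residue (\<lambda>w. (f w + 1) / g w) z - residue (\<lambda>w. 1 / g w) z"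
      using s f g nz
      by (intro residue_diff[of s]) (auto intro!: holomorphic_intros intro: holomorphic_on_subset)
    also have "\<dots> = 0"
      using res[of "\<lambda>w. f w + 1"] res[of "\<lambda>w. 1"] f True by (simp add: holomorphic_on_add)
    finally show ?thesis using True by (simp add: diff_divide_distrib[symmetric])
  qed (use res f in auto)
qed

lemma nsinc_shift:
  assumes "h > 0" "x \<noteq> of_int k * h"
  shows "nsinc ((x - of_int k * h) / h) = h * sin (pi * x / h) * cos (pi * of_int k) / (pi * (x - of_int k * h))"
proof -
  have e: "pi * ((x - of_int k * h) / h) = pi * x / h - pi * of_int k" using assms by (simp add: field_simps)
  have "nsinc ((x - of_int k * h) / h) = sin (pi * ((x - of_int k * h) / h)) / (pi * ((x - of_int k * h) / h))"
    using assms by (simp add: nsinc_def)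
  also have "sin (pi * ((x - of_int k * h) / h)) = sin (pi * x / h) * cos (pi * of_int k)"
    unfolding e by (simp only: sin_diff sin_npi_int mult_zero_right diff_zero)
  finally show ?thesis by simp
qed

lemma nsinc_diff_int: "nsinc ((of_int j * h - of_int k * h) / h) = (if j = k then 1 else 0)" if "h > 0"
proof -
  have "(of_int j * h - of_int k * h) / h = of_int (j - k)" using that by (simp add: field_simps)
  then show ?thesis using sin_npi_int[of "j - k"] by (simp add: nsinc_def del: sin_npi_int)
qed

lemma sin_scaled_eq_0_iff:
  assumes "h > 0"
  shows "sin (complex_of_real pi * z / of_real h) = 0 \<longleftrightarrow> (\<exists>k::int. z = of_real (of_int k * h))"
proof -
  have "complex_of_real pi * z / of_real h = of_real (of_int k * pi) \<longleftrightarrow> z = of_real (of_int k * h)" for k :: int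
    using assms by (simp add: field_simps)
  then show ?thesis unfolding sin_eq_0 by simp
qed

text \<open>
The simple poles are \<open>x\<close> and the nodes \<open>k h\<close> with \<open>|k| \<le> m\<close>. The residue at \<open>k h\<close> contains the factor
\<open>1 / cos (\<pi> k) = (-1)^k\<close>, which turns \<open>sin (\<pi> x / h)\<close> into the sine in the shifted cardinal function. The
second claim supplies continuity of the integrand on the contour.
\<close>

lemma sinc_rectangle_integral:
  fixes m :: nat and x h :: real
  assumes F: "F holomorphic_on strip d" and a: "0 < a" "a < d" and h: "h > 0"
    and X: "X = (real m + 1/2) * h" and x: "\<bar>x\<bar> < X" "\<And>k::int. x \<noteq> of_int k * h"
  defines "G \<equiv> \<lambda>z. F z / ((z - of_real x) * sin (of_real pi * z / of_real h))"
  shows "contour_integral (rectpath (Complex (-X) (-a)) (Complex X a)) G =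
     2 * of_real pi * \<i> / of_real (sin (pi * x / h)) *
     (F (of_real x) - (\<Sum>k\<in>{- int m..int m}. F (of_real (of_int k * h)) * of_real (nsinc ((x - of_int k * h) / h))))"
    and "path_image (rectpath (Complex (-X) (-a)) (Complex X a)) \<subseteq>
       {z. z \<in> strip d \<and> (z - of_real x) * sin (of_real pi * z / of_real h) \<noteq> 0}"
proof -
  define g :: "complex \<Rightarrow> complex" where "g = (\<lambda>z. (z - of_real x) * sin (of_real pi * z / of_real h))"
  \<comment> \<open>slightly wider than the contour, yet with the same finitely many zeros of the sine\<close>
  define S where "S = box (Complex (- ((real m + 1) * h)) (- d)) (Complex ((real m + 1) * h) d)"
  define P where "P = (\<lambda>k::int. complex_of_real (of_int k * h)) ` {- int m..int m}"
  let ?r = "rectpath (Complex (-X) (-a)) (Complex X a)"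
  have X0: "0 < X" using X h by simp
  have S_strip: "S \<subseteq> strip d" by (auto simp: S_def strip_def in_box_complex_iff)
  have sx: "sin (pi * x / h) \<noteq> 0"
    using sin_scaled_eq_0_iff[OF h, of "of_real x"] x(2)
    by (metis of_real_divide of_real_eq_0_iff of_real_eq_iff of_real_mult sin_of_real)
  have xP: "of_real x \<notin> P" unfolding P_def image_iff of_real_eq_iff using x(2) by blast
  have g0: "g z = 0 \<longleftrightarrow> z \<in> insert (of_real x) P" if "z \<in> S" for z
  proof -
    have "\<bar>k\<bar> \<le> int m" if "z = of_real (of_int k * h)" for k :: int
    proof -
      have "\<bar>of_int k * h\<bar> < (real m + 1) * h" using that \<open>z \<in> S\<close> by (auto simp: S_def in_box_complex_iff)
      then have "\<bar>of_int k\<bar> < real m + 1" using h by (simp add: abs_mult)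
      then show ?thesis by linarith
    qed
    then have "(\<exists>k::int. z = of_real (of_int k * h)) \<longleftrightarrow> z \<in> P"
      unfolding P_def image_iff by (metis abs_le_iff atLeastAtMost_iff minus_le_iff)
    then show ?thesis by (simp add: g_def sin_scaled_eq_0_iff[OF h])
  qed
  have k_less: "\<bar>of_int k * h\<bar> < X" if "k \<in> {- int m..int m}" for k
  proof -
    have "\<bar>of_int k\<bar> \<le> real m" using that by auto
    then have "\<bar>of_int k\<bar> * h < (real m + 1/2) * h" using h by (intro mult_strict_right_mono) auto
    then show ?thesis using h X by (simp add: abs_mult)
  qed
  have P_in: "insert (of_real x) P \<subseteq> box (Complex (-X) (-a)) (Complex X a)"
    using x(1) k_less a by (auto simp: P_def in_box_complex_iff abs_less_iff minus_less_iff)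
  have cb: "cbox (Complex (-X) (-a)) (Complex X a) \<subseteq> S"
    using a h X by (auto simp: S_def in_box_complex_iff in_cbox_complex_iff algebra_simps)
  have img: "path_image ?r \<subseteq> S - insert (of_real x) P"
    using path_image_rectpath_cbox_minus_box[of "Complex (-X) (-a)" "Complex X a"] P_in cb X0 a by auto
  show "path_image ?r \<subseteq> {z. z \<in> strip d \<and> (z - of_real x) * sin (of_real pi * z / of_real h) \<noteq> 0}"
    using img S_strip g0 by (fastforce simp: g_def)
  have FS: "F holomorphic_on S" using F S_strip by (rule holomorphic_on_subset)
  have gS: "g holomorphic_on T" for T unfolding g_def using h by (intro holomorphic_intros) auto
  have finP: "finite P" by (simp add: P_def)
  have opS: "open S" unfolding S_def by (rule open_box)
  have res: "residue G p = F p / g'" if "p \<in> insert (of_real x) P" "(g has_field_derivative g') (at p)" "g' \<noteq> 0" for p g'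
  proof -
    let ?T = "S - (insert (of_real x) P - {p})"
    have "residue (\<lambda>w. F w / g w) p = F p / g'"
    proof (rule residue_divide_simple_zero[of _ ?T])
      show "open ?T" using opS finP by (intro open_Diff finite_imp_closed) auto
      show "p \<in> ?T" using that(1) P_in cb box_subset_cbox by blast
      then show "g p = 0" using that g0 by blast
    qed (use FS gS g0 that in \<open>auto intro: holomorphic_on_subset\<close>)
    then show ?thesis unfolding G_def g_def .
  qed
  have dg: "(g has_field_derivative sin (of_real pi * p / of_real h) +
      (p - of_real x) * (cos (of_real pi * p / of_real h) * (of_real pi / of_real h))) (at p)" for p
    unfolding g_def using h by (auto intro!: derivative_eq_intros)
  have res_x: "residue G (of_real x) = F (of_real x) / of_real (sin (pi * x / h))"
  proof (rule res)
    have "sin (of_real pi * of_real x / of_real h) = complex_of_real (sin (pi * x / h))"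
      by (metis of_real_divide of_real_mult sin_of_real)
    then show "(g has_field_derivative of_real (sin (pi * x / h))) (at (of_real x))"
      using dg[of "of_real x"] by simp
  qed (use sx in auto)
  have res_k: "residue G (of_real (of_int k * h)) =
     - (F (of_real (of_int k * h)) * of_real (nsinc ((x - of_int k * h) / h))) / of_real (sin (pi * x / h))"
    if k: "k \<in> {- int m..int m}" for k
  proof -
    define c where "c = cos (pi * of_int k)"
    have c: "c = 1 \<or> c = -1" by (simp add: c_def)
    have e: "complex_of_real pi * of_real (of_int k * h) / of_real h = of_real (pi * of_int k)" using h by simp
    have "(g has_field_derivative of_real ((of_int k * h - x) * (c * (pi / h)))) (at (of_real (of_int k * h)))"
      using dg[of "of_real (of_int k * h)"] unfolding e sin_of_real cos_of_real c_def by simp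
    moreover have "c \<noteq> 0" using c by auto
    moreover from this have "(of_int k * h - x) * (c * (pi / h)) \<noteq> 0" using x(2)[of k] h by simp
    then have "complex_of_real ((of_int k * h - x) * (c * (pi / h))) \<noteq> 0" unfolding of_real_eq_0_iff .
    ultimately have "residue G (of_real (of_int k * h)) = F (of_real (of_int k * h)) / of_real ((of_int k * h - x) * (c * (pi / h)))"
      using k by (intro res) (auto simp: P_def)
    also have "\<dots> = F (of_real (of_int k * h)) * of_real (1 / ((of_int k * h - x) * (c * (pi / h))))"
      by (simp add: divide_inverse)
    also have "1 / ((of_int k * h - x) * (c * (pi / h))) = - (nsinc ((x - of_int k * h) / h)) / sin (pi * x / h)"
      unfolding nsinc_shift[OF h x(2)] c_def[symmetric] using sx h x(2)[of k] c
      by (auto simp: divide_simps) (simp_all add: algebra_simps)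
    finally show ?thesis by (simp add: divide_inverse)
  qed
  have "contour_integral ?r G = 2 * pi * \<i> * (\<Sum>p\<in>insert (of_real x) P. winding_number ?r p * residue G p)"
  proof (rule Residue_theorem[OF opS])
    show "connected S" unfolding S_def by (intro convex_connected convex_box)
    show "G holomorphic_on S - insert (of_real x) P"
      unfolding G_def using g0 FS gS
      by (intro holomorphic_intros) (auto simp: g_def intro: holomorphic_on_subset)
    show "\<forall>z. z \<notin> S \<longrightarrow> winding_number ?r z = 0"
      using cb X0 a by (intro allI impI winding_number_rectpath_outside) auto
  qed (use img finP in auto)
  also have "(\<Sum>p\<in>insert (of_real x) P. winding_number ?r p * residue G p) = (\<Sum>p\<in>insert (of_real x) P. residue G p)"
    using P_in by (intro sum.cong) (auto simp: winding_number_rectpath)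
  also have "\<dots> = residue G (of_real x) + (\<Sum>p\<in>P. residue G p)" using xP finP by simp
  also have "(\<Sum>p\<in>P. residue G p) = (\<Sum>k\<in>{- int m..int m}. residue G (of_real (of_int k * h)))"
    unfolding P_def using h by (subst sum.reindex) (auto simp: inj_on_def)
  also have "\<dots> = (\<Sum>k\<in>{- int m..int m}. - (F (of_real (of_int k * h)) * of_real (nsinc ((x - of_int k * h) / h))) / of_real (sin (pi * x / h)))"
    by (intro sum.cong res_k) auto
  also have "\<dots> = - (\<Sum>k\<in>{- int m..int m}. F (of_real (of_int k * h)) * of_real (nsinc ((x - of_int k * h) / h))) / of_real (sin (pi * x / h))"
    by (simp only: sum_divide_distrib[symmetric] sum_negf)
  finally show "contour_integral ?r G =
     2 * of_real pi * \<i> / of_real (sin (pi * x / h)) *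
     (F (of_real x) - (\<Sum>k\<in>{- int m..int m}. F (of_real (of_int k * h)) * of_real (nsinc ((x - of_int k * h) / h))))"
    unfolding res_x using sx by (simp add: field_simps)
qed

lemma norm_sin_ge_sinh: "sinh \<bar>Im z\<bar> \<le> norm (sin z)"
proof (rule power2_le_imp_le)
  have r: "Re (sin z) = sin (Re z) * cosh (Im z)" "Im (sin z) = cos (Re z) * sinh (Im z)"
    by (simp_all add: Re_sin Im_sin cosh_field_def sinh_field_def)
  have "(sinh (Im z))\<^sup>2 \<le> (sin (Re z))\<^sup>2 * ((cosh (Im z))\<^sup>2 - (sinh (Im z))\<^sup>2) + (sinh (Im z))\<^sup>2"
    by (simp add: cosh_square_eq)
  also have "\<dots> = (sin (Re z) * cosh (Im z))\<^sup>2 + (cos (Re z) * sinh (Im z))\<^sup>2"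
    unfolding power_mult_distrib cos_squared_eq by (simp add: algebra_simps)
  finally show "(sinh \<bar>Im z\<bar>)\<^sup>2 \<le> (norm (sin z))\<^sup>2" by (simp add: cmod_power2 r)
qed simp

text \<open>
Midway between two nodes the sine reduces to \<open>\<plusminus> cosh\<close> of the imaginary part. This is why the vertical
sides of the contour are placed at \<open>\<plusminus> (m + 1/2) h\<close>.
\<close>

lemma norm_sin_ge_1:
  assumes "\<bar>Re z\<bar> = (real m + 1/2) * pi" shows "1 \<le> norm (sin z)"
proof -
  have "\<bar>sin ((real m + 1/2) * pi)\<bar> = 1"
    using arg_cong[OF sin_cos_npi[of m], of abs] by (simp add: field_simps)
  moreover have "\<bar>sin \<bar>Re z\<bar>\<bar> = \<bar>sin (Re z)\<bar>" by (simp add: abs_if)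
  ultimately have "\<bar>sin (Re z)\<bar> = 1" using assms by simp
  then have "\<bar>Re (sin z)\<bar> = cosh (Im z)" by (simp add: Re_sin abs_mult cosh_field_def add_nonneg_nonneg)
  then show ?thesis using abs_Re_le_cmod[of "sin z"] cosh_real_ge_1[of "Im z"] by linarith
qed

text \<open>
The factor \<open>cosh s \<ge> 1\<close> is inserted to make the double exponential majorant elementary to integrate.
\<close>

lemma DE_decay_has_integral:
  fixes \<kappa> X :: real
  assumes "\<kappa> > 0" "X \<ge> 0"
  shows "((\<lambda>s. exp (- \<kappa> * \<bar>sinh s\<bar>) * cosh s) has_integral (2 * (1 - exp (- \<kappa> * sinh X)) / \<kappa>)) {-X..X}"
proof -
  \<comment> \<open>\<open>1 - exp (- \<kappa> sinh s)\<close> on the right and \<open>exp (\<kappa> sinh s) - 1\<close> on the left, over \<open>\<kappa>\<close>; this form is visibly continuous\<close>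
  define \<Phi> where "\<Phi> s = (exp (min 0 (\<kappa> * sinh s)) - exp (- max 0 (\<kappa> * sinh s))) / \<kappa>" for s
  have "((\<lambda>s. exp (- \<kappa> * \<bar>sinh s\<bar>) * cosh s) has_integral (\<Phi> X - \<Phi> (-X))) {-X..X}"
  proof (rule fundamental_theorem_of_calculus_interior_strong[of "{0}"])
    show "continuous_on {-X..X} \<Phi>" unfolding \<Phi>_def using assms by (intro continuous_intros) auto
    fix s assume "s \<in> {-X<..<X} - {0}"
    then consider "s > 0" | "s < 0" by fastforce
    then have "(\<Phi> has_real_derivative exp (- \<kappa> * \<bar>sinh s\<bar>) * cosh s) (at s)"
    proof cases
      case 1
      have "((\<lambda>s. (1 - exp (- (\<kappa> * sinh s))) / \<kappa>) has_real_derivative exp (- \<kappa> * \<bar>sinh s\<bar>) * cosh s) (at s)"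
        using 1 assms by (auto intro!: derivative_eq_intros)
      then show ?thesis
        by (rule has_field_derivative_transform_within_open[of _ _ _ "{0<..}"]) (use 1 assms in \<open>auto simp: \<Phi>_def\<close>)
    next
      case 2
      have "((\<lambda>s. (exp (\<kappa> * sinh s) - 1) / \<kappa>) has_real_derivative exp (- \<kappa> * \<bar>sinh s\<bar>) * cosh s) (at s)"
        using 2 assms by (auto intro!: derivative_eq_intros)
      moreover have "\<kappa> * sinh t \<le> 0" if "t < 0" for t
        using that assms by (simp add: mult_nonneg_nonpos)
      ultimately show ?thesis
        using 2 by (elim has_field_derivative_transform_within_open[of _ _ _ "{..<0}"])
          (auto simp: \<Phi>_def min_absorb2 max_absorb1)
    qed
    then show "(\<Phi> has_vector_derivative exp (- \<kappa> * \<bar>sinh s\<bar>) * cosh s) (at s)"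
      by (simp add: has_real_derivative_iff_has_vector_derivative)
  qed (use assms in auto)
  moreover have "\<Phi> X - \<Phi> (-X) = 2 * (1 - exp (- \<kappa> * sinh X)) / \<kappa>"
    using assms by (simp add: \<Phi>_def min_def max_def mult_le_0_iff field_simps)
  ultimately show ?thesis by simp
qed

lemma norm_contour_integral_horizontal_le:
  fixes X y W :: real and w :: "real \<Rightarrow> real"
  assumes X: "X > 0" and f: "f contour_integrable_on linepath (Complex (-X) y) (Complex X y)"
    and w: "(w has_integral W) {-X..X}"
    and le: "\<And>s. s \<in> {-X..X} \<Longrightarrow> norm (f (Complex s y)) \<le> w s"
  shows "norm (contour_integral (linepath (Complex (-X) y) (Complex X y)) f) \<le> W"
proof -
  let ?l = "linepath (Complex (-X) y) (Complex X y)"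
  have "((\<lambda>t. w ((2 * X) *\<^sub>R t + (-X))) has_integral (W /\<^sub>R (2 * X) ^ DIM(real)))
     (cbox ((-X - (-X)) /\<^sub>R (2 * X)) ((X - (-X)) /\<^sub>R (2 * X)))"
    by (rule has_integral_affinity') (use w X in auto)
  then have "((\<lambda>t. w (2 * X * t - X)) has_integral (W / (2 * X))) {0..1}"
    using X by (simp add: field_simps)
  from has_integral_mult_right[OF this, of "2 * X"]
  have w': "((\<lambda>t. 2 * X * w (2 * X * t - X)) has_integral W) {0..1}" using X by simp
  have "Complex X y - Complex (-X) y = of_real (2 * X)" by (simp add: complex_eq_iff)
  then have d: "norm (Complex X y - Complex (-X) y) = 2 * X" using X by (simp only: norm_of_real)
  have l: "?l t = Complex (2 * X * t - X) y" for t
    by (simp add: linepath_def complex_eq_iff algebra_simps)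
  have "norm (integral {0..1} (\<lambda>t. f (?l t) * (Complex X y - Complex (-X) y))) \<le>
      integral {0..1} (\<lambda>t. 2 * X * w (2 * X * t - X))"
  proof (rule integral_norm_bound_integral)
    show "(\<lambda>t. f (?l t) * (Complex X y - Complex (-X) y)) integrable_on {0..1}"
      using f by (simp add: contour_integrable_on vector_derivative_linepath_within cong: integrable_cong)
    show "(\<lambda>t. 2 * X * w (2 * X * t - X)) integrable_on {0..1}" using w' by blast
    fix t :: real assume t: "t \<in> {0..1}"
    then have "2 * X * t - X \<in> {-X..X}" using X by (auto simp: mult_left_le)
    then have "norm (f (?l t)) \<le> w (2 * X * t - X)" unfolding l by (rule le)
    then show "norm (f (?l t) * (Complex X y - Complex (-X) y)) \<le> 2 * X * w (2 * X * t - X)"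
      unfolding norm_mult d using X by (simp add: mult.commute mult_left_mono)
  qed
  also have "\<dots> = W" using w' by (rule integral_unique)
  also have "integral {0..1} (\<lambda>t. f (?l t) * (Complex X y - Complex (-X) y)) = contour_integral ?l f"
    unfolding contour_integral_integral
    by (intro integral_cong) (simp add: vector_derivative_linepath_within)
  finally show ?thesis .
qed

text \<open>
The first summand comes from the horizontal sides, where \<open>|z - x| \<ge> a\<close> and
\<open>|sin (\<pi> z / h)| \<ge> sinh (\<pi> a / h)\<close>, the second from the vertical sides. At a node the cardinal series
reproduces \<open>F\<close> exactly, so the bound extends to all \<open>x\<close> inside the rectangle.
\<close>

lemma norm_sinc_rectangle_error:
  fixes m :: nat and x h X K \<kappa> :: real
  assumes F: "F holomorphic_on strip d" and a: "0 < a" "a < d" and h: "h > 0"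
    and X: "X = (real m + 1/2) * h" and x: "\<bar>x\<bar> < X"
    and K: "K \<ge> 0" "\<kappa> > 0" "\<And>s y. \<bar>y\<bar> \<le> a \<Longrightarrow> norm (F (Complex s y)) \<le> K * exp (- \<kappa> * \<bar>sinh s\<bar>)"
  shows "norm (F (of_real x) - (\<Sum>k\<in>{- int m..int m}. F (of_real (of_int k * h)) * of_real (nsinc ((x - of_int k * h) / h))))
    \<le> 2 * K / (pi * \<kappa> * a * sinh (pi * a / h)) + 2 * K * a / (pi * (X - \<bar>x\<bar>))"
    (is "norm ?E \<le> ?B")
proof (cases "\<exists>k::int. x = of_int k * h")
  case True
  then obtain j :: int where j: "x = of_int j * h" by blast
  have "\<bar>of_int j\<bar> * h < (real m + 1/2) * h" using x X h j by (simp add: abs_mult)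
  then have "\<bar>of_int j\<bar> < real m + 1/2" using h by simp
  then have jm: "j \<in> {- int m..int m}" by auto
  have "(\<Sum>k\<in>{- int m..int m}. F (of_real (of_int k * h)) * of_real (nsinc ((x - of_int k * h) / h)))
      = (\<Sum>k\<in>{- int m..int m}. if j = k then F (of_real (of_int k * h)) else 0)"
    unfolding j using nsinc_diff_int[OF h] by (intro sum.cong) auto
  then have "norm ?E = 0" using jm j by simp
  also have "0 \<le> ?B" using K a h x by (intro add_nonneg_nonneg divide_nonneg_nonneg mult_nonneg_nonneg) auto
  finally show ?thesis .
next
  case False
  then have nx: "x \<noteq> of_int k * h" for k :: int by blast
  define G where "G = (\<lambda>z. F z / ((z - of_real x) * sin (of_real pi * z / of_real h)))"
  let ?r = "rectpath (Complex (-X) (-a)) (Complex X a)"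
  note rect = sinc_rectangle_integral[OF F a h X x nx, folded G_def]
  have X0: "0 < X" using X h by simp
  have G_cont: "G contour_integrable_on linepath p q"
    if "closed_segment p q \<subseteq> path_image ?r" for p q
  proof (rule contour_integrable_continuous_linepath)
    have sub: "closed_segment p q \<subseteq> {z. z \<in> strip d \<and> (z - of_real x) * sin (of_real pi * z / of_real h) \<noteq> 0}"
      using that rect(2) by (rule order.trans)
    have "continuous_on (closed_segment p q) F"
      using holomorphic_on_imp_continuous_on[OF F] by (rule continuous_on_subset) (use sub in auto)
    then show "continuous_on (closed_segment p q) G"
      unfolding G_def using sub h by (intro continuous_intros) auto
  qed
  define H V W where "H = K / (a * sinh (pi * a / h)) * (2 / \<kappa>)" and "V = K / (X - \<bar>x\<bar>) * (2 * a)"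
    and "W = 2 * (1 - exp (- \<kappa> * sinh X)) / \<kappa>"
  have sh: "0 < sinh (pi * a / h)" using a h by simp
  have horizontal: "norm (contour_integral (linepath (Complex (-X) y) (Complex X y)) G) \<le> H"
    if y: "\<bar>y\<bar> = a" for y
  proof -
    have seg: "closed_segment (Complex (-X) y) (Complex X y) \<subseteq> path_image ?r"
      using X0 a y by (subst path_image_rectpath)
        (auto simp: closed_segment_same_Im closed_segment_eq_real_ivl abs_if split: if_splits)
    have "norm (contour_integral (linepath (Complex (-X) y) (Complex X y)) G) \<le> K / (a * sinh (pi * a / h)) * W"
    proof (rule norm_contour_integral_horizontal_le[OF X0 G_cont[OF seg]])
      show "((\<lambda>s. K / (a * sinh (pi * a / h)) * (exp (- \<kappa> * \<bar>sinh s\<bar>) * cosh s)) has_integral K / (a * sinh (pi * a / h)) * W) {-X..X}"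
        unfolding W_def using DE_decay_has_integral[OF K(2), of X] X0 by (intro has_integral_mult_right) auto
      fix s :: real
      have "a \<le> norm (Complex s y - of_real x)"
        using abs_Im_le_cmod[of "Complex s y - of_real x"] y by simp
      moreover have "sinh (pi * a / h) \<le> norm (sin (of_real pi * Complex s y / of_real h))"
        using norm_sin_ge_sinh[of "of_real pi * Complex s y / of_real h"] y h by (simp add: abs_mult)
      ultimately have den: "a * sinh (pi * a / h) \<le> norm ((Complex s y - of_real x) * sin (of_real pi * Complex s y / of_real h))"
        unfolding norm_mult using sh a by (intro mult_mono) auto
      have "norm (G (Complex s y)) \<le> (K * exp (- \<kappa> * \<bar>sinh s\<bar>)) / (a * sinh (pi * a / h))"
        unfolding G_def norm_divide using K y a sh den by (intro frac_le) auto
      also have "\<dots> \<le> (K * (exp (- \<kappa> * \<bar>sinh s\<bar>) * cosh s)) / (a * sinh (pi * a / h))"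
        using K a sh cosh_real_ge_1[of s] by (intro divide_right_mono mult_left_mono) (auto simp: mult_le_cancel_left1)
      finally show "norm (G (Complex s y)) \<le> K / (a * sinh (pi * a / h)) * (exp (- \<kappa> * \<bar>sinh s\<bar>) * cosh s)" by simp
    qed
    also have "\<dots> \<le> H" unfolding H_def W_def
      using K a sh by (intro mult_left_mono divide_right_mono) auto
    finally show ?thesis .
  qed
  have vertical: "norm (contour_integral (linepath (Complex c (-a)) (Complex c a)) G) \<le> V"
    and vertical_int: "G contour_integrable_on (linepath (Complex c (-a)) (Complex c a))"
    if c: "\<bar>c\<bar> = X" for c
  proof -
    have seg: "closed_segment (Complex c (-a)) (Complex c a) \<subseteq> path_image ?r"
      using X0 a c by (subst path_image_rectpath)
        (auto simp: closed_segment_same_Re closed_segment_eq_real_ivl abs_if split: if_splits)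
    show int: "G contour_integrable_on (linepath (Complex c (-a)) (Complex c a))" by (rule G_cont[OF seg])
    have "norm (contour_integral (linepath (Complex c (-a)) (Complex c a)) G) \<le> K / (X - \<bar>x\<bar>) * norm (Complex c a - Complex c (-a))"
    proof (rule contour_integral_bound_linepath[OF int])
      show "0 \<le> K / (X - \<bar>x\<bar>)" using K x by simp
      fix z assume "z \<in> closed_segment (Complex c (-a)) (Complex c a)"
      then have z: "Re z = c" "\<bar>Im z\<bar> \<le> a" using a
        by (auto simp: closed_segment_same_Re closed_segment_eq_real_ivl)
      have "X - \<bar>x\<bar> \<le> norm (z - of_real x)"
        using abs_Re_le_cmod[of "z - of_real x"] z c by simp
      moreover have "1 \<le> norm (sin (of_real pi * z / of_real h))"
        using z c h X by (intro norm_sin_ge_1[of _ m]) (simp add: abs_mult)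
      ultimately have den: "(X - \<bar>x\<bar>) * 1 \<le> norm ((z - of_real x) * sin (of_real pi * z / of_real h))"
        unfolding norm_mult using x by (intro mult_mono) auto
      have "norm (F z) \<le> K * exp (- \<kappa> * \<bar>sinh c\<bar>)" using K(3)[OF z(2), of c] z(1) by (metis complex_surj)
      also have "\<dots> \<le> K" using K by (intro mult_left_le) auto
      finally show "norm (G z) \<le> K / (X - \<bar>x\<bar>)"
        unfolding G_def norm_divide using K x den by (intro frac_le) auto
    qed
    also have "Complex c a - Complex c (-a) = \<i> * of_real (2 * a)" by (simp add: complex_eq_iff)
    also have "norm \<dots> = 2 * a" using a by (simp add: norm_mult)
    finally show "norm (contour_integral (linepath (Complex c (-a)) (Complex c a)) G) \<le> V" by (simp add: V_def)
  qed
  have hor_int: "G contour_integrable_on (linepath (Complex (-X) y) (Complex X y))" if y: "\<bar>y\<bar> = a" for y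
    using X0 a y by (intro G_cont, subst path_image_rectpath)
        (auto simp: closed_segment_same_Im closed_segment_eq_real_ivl abs_if split: if_splits)
  define I1 I2 I3 I4 where "I1 = contour_integral (linepath (Complex (-X) (-a)) (Complex X (-a))) G"
    and "I2 = contour_integral (linepath (Complex X (-a)) (Complex X a)) G"
    and "I3 = contour_integral (linepath (Complex (-X) a) (Complex X a)) G"
    and "I4 = contour_integral (linepath (Complex (-X) (-a)) (Complex (-X) a)) G"
  have ints: "G contour_integrable_on (linepath (Complex (-X) (-a)) (Complex X (-a)))"
     "G contour_integrable_on (linepath (Complex X (-a)) (Complex X a))"
     "G contour_integrable_on (linepath (Complex X a) (Complex (-X) a))"
     "G contour_integrable_on (linepath (Complex (-X) a) (Complex (-X) (-a)))"
    using hor_int[of "-a"] hor_int[of a] vertical_int[of X] vertical_int[of "-X"] X0 a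
    by (auto simp: contour_integrable_on_def dest: has_contour_integral_reverse_linepath)
  have rev: "contour_integral (linepath q p) G = - contour_integral (linepath p q) G" for p q
    using contour_integral_reversepath[of "linepath p q" G] by simp
  have "contour_integral ?r G = I1 + I2 - I3 - I4"
    unfolding rectpath_def Let_def I1_def I2_def I3_def I4_def using ints
    by (simp add: rev[of "Complex X a" "Complex (-X) a"] rev[of "Complex (-X) a" "Complex (-X) (-a)"])
  also have "norm \<dots> \<le> norm I1 + norm I2 + norm I3 + norm I4"
    by (smt (verit) norm_triangle_ineq norm_triangle_ineq4)
  also have "\<dots> \<le> H + V + H + V"
    unfolding I1_def I2_def I3_def I4_def using X0 a by (intro add_mono horizontal vertical) auto
  finally have r: "norm (contour_integral ?r G) \<le> 2 * (H + V)" by simp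
  have s0: "sin (pi * x / h) \<noteq> 0"
  proof
    assume "sin (pi * x / h) = 0"
    then have "sin (of_real pi * of_real x / of_real h :: complex) = 0"
      by (metis of_real_0 of_real_divide of_real_mult sin_of_real)
    then show False unfolding sin_scaled_eq_0_iff[OF h] of_real_eq_iff using nx by blast
  qed
  have "norm (contour_integral ?r G) = 2 * pi / \<bar>sin (pi * x / h)\<bar> * norm ?E"
    unfolding rect(1) by (simp add: norm_mult norm_divide)
  moreover have "2 * pi / \<bar>sin (pi * x / h)\<bar> \<ge> 2 * pi"
    using s0 by (simp add: le_divide_eq mult_left_le)
  ultimately have "2 * pi * norm ?E \<le> 2 * (H + V)"
    using r mult_right_mono[of "2 * pi" "2 * pi / \<bar>sin (pi * x / h)\<bar>" "norm ?E"] by simp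
  then have "norm ?E \<le> (H + V) / pi" by (simp add: field_simps)
  also have "\<dots> = ?B" unfolding H_def V_def using K a sh x by (simp add: add_divide_distrib mult_ac)
  finally show ?thesis .
qed

section \<open>Truncation of the cardinal series\<close>

text \<open>
By convexity \<open>\<gamma> sinh ((N + j) h) \<ge> \<gamma> sinh (N h) + j z\<close> with \<open>z = \<gamma> h cosh (N h)\<close>. The resulting geometric
series has the sum \<open>1 / (exp z - 1) \<le> 1 / z\<close>.
\<close>

lemma sum_exp_sinh_tail_le:
  fixes h \<gamma> :: real and N m :: int
  assumes h: "h > 0" and \<gamma>: "\<gamma> > 0" and N: "N \<ge> 0"
  shows "(\<Sum>k\<in>{N + 1..m}. exp (- \<gamma> * sinh (of_int k * h)))
     \<le> exp (- \<gamma> * sinh (of_int N * h)) / (\<gamma> * h * cosh (of_int N * h))"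
proof -
  define z where "z = \<gamma> * h * cosh (of_int N * h)"
  have z: "z > 0" using h \<gamma> by (simp add: z_def)
  define E where "E = exp (- \<gamma> * sinh (of_int N * h))"
  have "(\<Sum>k\<in>{N + 1..m}. exp (- \<gamma> * sinh (of_int k * h))) =
      (\<Sum>j<nat (m - N). exp (- \<gamma> * sinh (of_int (N + 1 + int j) * h)))"
    by (rule sum.reindex_bij_witness[of _ "\<lambda>j. N + 1 + int j" "\<lambda>k. nat (k - N - 1)"]) auto
  also have "\<dots> \<le> (\<Sum>j<nat (m - N). E * (exp (-z) * exp (-z) ^ j))"
  proof (rule sum_mono)
    fix j
    have "sinh (of_int N * h) + (of_int (N + 1 + int j) * h - of_int N * h) * cosh (of_int N * h) \<le> sinh (of_int (N + 1 + int j) * h)"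
      using h N by (intro sinh_ge_tangent) (auto intro: mult_right_mono)
    then have "\<gamma> * sinh (of_int N * h) + real (Suc j) * z \<le> \<gamma> * sinh (of_int (N + 1 + int j) * h)"
      using mult_left_mono[of _ _ \<gamma>] \<gamma> by (fastforce simp: z_def algebra_simps)
    then have "exp (- \<gamma> * sinh (of_int (N + 1 + int j) * h)) \<le> exp (- \<gamma> * sinh (of_int N * h) + real (Suc j) * (-z))"
      by simp
    also have "\<dots> = E * exp (-z) ^ Suc j" unfolding E_def exp_add exp_of_nat_mult ..
    finally show "exp (- \<gamma> * sinh (of_int (N + 1 + int j) * h)) \<le> E * (exp (-z) * exp (-z) ^ j)" by simp
  qed
  also have "\<dots> = E * exp (-z) * (\<Sum>j<nat (m - N). exp (-z) ^ j)"
    by (simp add: sum_distrib_left mult.assoc)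
  also have "\<dots> \<le> E * exp (-z) * (1 / (1 - exp (-z)))"
    using z by (intro mult_left_mono) (auto simp: sum_gp_strict E_def intro!: divide_right_mono)
  also have "\<dots> = E / (exp z - 1)" using z by (simp add: exp_minus field_simps)
  also have "\<dots> \<le> E / z"
  proof (rule divide_left_mono)
    show "z \<le> exp z - 1" using exp_ge_add_one_self[of z] by linarith
  qed (use z in \<open>auto simp: E_def\<close>)
  finally show ?thesis by (simp add: E_def z_def)
qed

lemma abs_nsinc_le_1: "\<bar>nsinc x\<bar> \<le> 1"
  using abs_sin_x_le_abs_x[of "pi * x"] by (simp add: nsinc_def abs_divide divide_le_eq)

lemma norm_sinc_truncation_le:
  fixes h R \<alpha> \<beta> x :: real and M N :: int and m :: nat
  assumes h: "h > 0" and pos: "R > 0" "\<alpha> > 0" "\<beta> > 0" and MN: "0 \<le> M" "0 \<le> N" "M \<le> int m" "N \<le> int m"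
    and right: "\<And>x. norm (F (complex_of_real x)) \<le> R * exp (- (pi * \<beta>) * sinh x)"
    and left: "\<And>x. norm (F (complex_of_real x)) \<le> R * exp (- (pi * \<alpha>) * sinh (-x))"
  defines "S \<equiv> \<lambda>k::int. F (of_real (of_int k * h)) * complex_of_real (nsinc ((x - of_int k * h) / h))"
  shows "norm ((\<Sum>k\<in>{- int m..int m}. S k) - (\<Sum>k\<in>{-M..N}. S k)) \<le>
     R * (exp (- (pi * \<alpha>) * sinh (of_int M * h)) / (pi * \<alpha> * h * cosh (of_int M * h))) +
     R * (exp (- (pi * \<beta>) * sinh (of_int N * h)) / (pi * \<beta> * h * cosh (of_int N * h)))"
proof -
  have S: "norm (S k) \<le> norm (F (of_real (of_int k * h)))" for k
    unfolding S_def norm_mult norm_of_real using abs_nsinc_le_1 by (intro mult_left_le) auto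
  have "{- int m..int m} = ({- int m..-M - 1} \<union> {-M..N}) \<union> {N + 1..int m}" using MN by auto
  then have "(\<Sum>k\<in>{- int m..int m}. S k) = sum S {- int m..-M - 1} + sum S {-M..N} + sum S {N + 1..int m}"
    using MN by (simp only:) (subst sum.union_disjoint; auto)+
  then have "norm ((\<Sum>k\<in>{- int m..int m}. S k) - (\<Sum>k\<in>{-M..N}. S k)) = norm (sum S {- int m..-M - 1} + sum S {N + 1..int m})"
    by simp
  also have "\<dots> \<le> norm (sum S {- int m..-M - 1}) + norm (sum S {N + 1..int m})" by (rule norm_triangle_ineq)
  also have "norm (sum S {- int m..-M - 1}) \<le> (\<Sum>k\<in>{- int m..-M - 1}. R * exp (- (pi * \<alpha>) * sinh (- (of_int k * h))))"
    by (intro sum_norm_le order.trans[OF S] left)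
  also have "\<dots> = (\<Sum>k\<in>{M + 1..int m}. R * exp (- (pi * \<alpha>) * sinh (of_int k * h)))"
    by (rule sum.reindex_bij_witness[of _ uminus uminus]) auto
  also have "\<dots> = R * (\<Sum>k\<in>{M + 1..int m}. exp (- (pi * \<alpha>) * sinh (of_int k * h)))" by (simp add: sum_distrib_left)
  also have "\<dots> \<le> R * (exp (- (pi * \<alpha>) * sinh (of_int M * h)) / (pi * \<alpha> * h * cosh (of_int M * h)))"
    using pos h MN by (intro mult_left_mono sum_exp_sinh_tail_le) auto
  also have "norm (sum S {N + 1..int m}) \<le> (\<Sum>k\<in>{N + 1..int m}. R * exp (- (pi * \<beta>) * sinh (of_int k * h)))"
    by (intro sum_norm_le order.trans[OF S] right)
  also have "\<dots> = R * (\<Sum>k\<in>{N + 1..int m}. exp (- (pi * \<beta>) * sinh (of_int k * h)))" by (simp add: sum_distrib_left)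
  also have "\<dots> \<le> R * (exp (- (pi * \<beta>) * sinh (of_int N * h)) / (pi * \<beta> * h * cosh (of_int N * h)))"
    using pos h MN by (intro mult_left_mono sum_exp_sinh_tail_le) auto
  finally show ?thesis by simp
qed

lemma LDE_bound_real:
  assumes F: "F \<in> LDE L R \<alpha> \<beta> d" and pos: "R > 0" "\<alpha> > 0" "\<beta> > 0"
  shows "norm (F (complex_of_real x)) \<le> R * exp (- (pi * \<beta>) * sinh x)"
    and "norm (F (complex_of_real x)) \<le> R * exp (- (pi * \<alpha>) * sinh (-x))"
proof -
  let ?P = "(1 + exp (- pi * sinh x)) powr \<alpha>" and ?Q = "(1 + exp (pi * sinh x)) powr \<beta>"
  have F': "norm (F (of_real x)) \<le> R / (?P * ?Q)" using F by (simp add: LDE_def)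
  note P = one_plus_exp_powr_ge[OF pos(2), of "- pi * sinh x"]
  note Q = one_plus_exp_powr_ge[OF pos(3), of "pi * sinh x"]
  have PQ: "0 < ?P * ?Q" using P(1) Q(1) by (intro mult_pos_pos) linarith+
  have "1 * exp (\<beta> * (pi * sinh x)) \<le> ?P * ?Q" using P Q by (intro mult_mono) auto
  then have "R / (?P * ?Q) \<le> R / exp (\<beta> * (pi * sinh x))" using pos PQ by (intro divide_left_mono mult_pos_pos[OF PQ]) auto
  then show "norm (F (of_real x)) \<le> R * exp (- (pi * \<beta>) * sinh x)" 
    using F' by (simp add: exp_minus divide_inverse mult_ac)
  have "exp (\<alpha> * (- pi * sinh x)) * 1 \<le> ?P * ?Q" using P Q by (intro mult_mono) auto
  then have "R / (?P * ?Q) \<le> R / exp (\<alpha> * (- pi * sinh x))" using pos PQ by (intro divide_left_mono mult_pos_pos[OF PQ]) auto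
  then show "norm (F (of_real x)) \<le> R * exp (- (pi * \<alpha>) * sinh (-x))" 
    using F' by (simp add: exp_minus divide_inverse mult_ac)
qed

section \<open>Constants independent of the number of nodes\<close>

lemma pq_fun_arsinh: "p_fun t = sinh (arsinh t) / cutoff (arsinh t)" "q_fun t = sinh (arsinh t) / arsinh t"
  "arsinh (q_fun t) = cutoff (arsinh t)" "q_fun t = sinh (cutoff (arsinh t))"
  by (simp_all add: p_fun_def q_fun_def cutoff_def)

lemma arsinh_mono: "s \<le> t \<Longrightarrow> arsinh s \<le> arsinh (t::real)"
  using arsinh_less_iff_real[of t s] by linarith

lemma q_fun_pos: "0 < t \<Longrightarrow> 0 < q_fun t" by (simp add: q_fun_def)

lemma q_fun_mono: "0 < s \<Longrightarrow> s \<le> t \<Longrightarrow> q_fun s \<le> q_fun t"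
  unfolding pq_fun_arsinh(2) by (intro sinh_div_mono arsinh_mono) auto

lemma p_fun_minus_q_fun_mono: "0 < s \<Longrightarrow> s \<le> t \<Longrightarrow> p_fun s - q_fun s \<le> p_fun t - q_fun t"
  unfolding pq_fun_arsinh(1,2) by (intro pq_diff_mono arsinh_mono) auto

lemma p_fun_mono: "0 < s \<Longrightarrow> s \<le> t \<Longrightarrow> p_fun s \<le> p_fun t"
  using q_fun_mono[of s t] p_fun_minus_q_fun_mono[of s t] by linarith

text \<open>
Both tails are treated at once: \<open>\<gamma>\<close> is \<open>\<alpha>\<close> or \<open>\<beta>\<close> and \<open>y\<close> the abscissa of the last node kept on that
side. The hypothesis on \<open>y\<close> gives \<open>\<gamma> sinh y \<ge> \<mu> sinh (n h)\<close> and hence, since \<open>\<gamma> \<ge> \<mu>\<close>, also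
\<open>\<gamma> cosh y \<ge> \<mu> cosh (n h)\<close>. After that only \<open>cutoff_coth_ge\<close> is needed, because \<open>t = u sinh (n h)\<close>. Each
tail contributes half of \<open>1 / d\<close>.
\<close>

lemma tail_coefficient_le:
  fixes \<mu> d h \<gamma> y :: real and n :: nat
  assumes pos: "0 < \<mu>" "0 < d" "0 < n" and \<gamma>: "\<mu> \<le> \<gamma>"
    and h: "h = arsinh (q_fun (d * real n / \<mu>)) / real n"
    and y: "\<mu> / \<gamma> * q_fun (d * real n / \<mu>) \<le> sinh y"
  shows "exp (- (pi * \<gamma>) * sinh y) / (pi * \<gamma> * h * cosh y) \<le> exp (- pi * \<mu> * q_fun (d * real n / \<mu>)) / (2 * d)"
proof (rule frac_le)
  define t where "t = d * real n / \<mu>"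
  define u where "u = arsinh t"
  have t: "t > 0" using pos by (simp add: t_def)
  then have u: "u > 0" by (simp add: u_def)
  have q: "q_fun t = sinh (cutoff u)" unfolding u_def by (rule pq_fun_arsinh)
  have nh: "real n * h = cutoff u"
    unfolding h t_def[symmetric] pq_fun_arsinh(3) u_def using pos by simp
  have A: "cutoff u > 0" using u by (rule cutoff_pos)
  have y': "\<mu> * sinh (cutoff u) \<le> \<gamma> * sinh y"
    using y \<gamma> pos unfolding t_def[symmetric] q by (simp add: field_simps)
  show "exp (- (pi * \<gamma>) * sinh y) \<le> exp (- pi * \<mu> * q_fun (d * real n / \<mu>))"
    unfolding t_def[symmetric] q using y' by simp
  have "\<mu> * cosh (cutoff u) \<le> \<gamma> * cosh y"
  proof (rule power2_le_imp_le)
    have "(\<mu> * sinh (cutoff u))\<^sup>2 \<le> (\<gamma> * sinh y)\<^sup>2" using y' A pos by (intro power_mono) auto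
    moreover have "\<mu>\<^sup>2 \<le> \<gamma>\<^sup>2" using \<gamma> pos by (intro power_mono) auto
    ultimately show "(\<mu> * cosh (cutoff u))\<^sup>2 \<le> (\<gamma> * cosh y)\<^sup>2"
      unfolding power_mult_distrib cosh_square_eq by (simp add: algebra_simps)
  qed (use \<gamma> pos in auto)
  have h0: "0 < h" using nh A pos by (metis of_nat_0_less_iff zero_less_mult_pos)
  have "2 * d * real n = 2 * \<mu> * t" using pos by (simp add: t_def)
  also have "t = u * sinh (cutoff u)" using u by (simp add: sinh_cutoff u_def)
  also have "2 * \<mu> * (u * sinh (cutoff u)) = \<mu> * pi * (2 / pi * u * sinh (cutoff u))" by simp
  also have "\<dots> \<le> \<mu> * pi * (cutoff u * cosh (cutoff u))" using pos u by (intro mult_left_mono cutoff_coth_ge) auto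
  also have "\<dots> = (pi * h * (\<mu> * cosh (cutoff u))) * real n" unfolding nh[symmetric] by simp
  also have "\<dots> \<le> (pi * h * (\<gamma> * cosh y)) * real n"
    using \<open>\<mu> * cosh (cutoff u) \<le> \<gamma> * cosh y\<close> h0 by (intro mult_right_mono mult_left_mono) auto
  finally have "2 * d * real n \<le> (pi * h * (\<gamma> * cosh y)) * real n" .
  then show "2 * d \<le> pi * \<gamma> * h * cosh y" using pos by (simp add: mult_ac)
qed (use assms in auto)

text \<open>
With \<open>z = \<pi> d / h = \<pi> \<mu> (p_fun t)\<close> one has \<open>1 / sinh z = 2 exp (- z) / (1 - exp (- 2 z))\<close>. The numerator
is compared through the monotonicity of \<open>p_fun - q_fun\<close>, the denominator through that of \<open>p_fun\<close>; both
are compared with their values at \<open>d / \<mu>\<close>, which is \<open>t\<close> for \<open>n = 1\<close>.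
\<close>

lemma inverse_sinh_le_rate:
  fixes \<mu> d h :: real and n :: nat
  assumes pos: "0 < \<mu>" "0 < d" "0 < n"
    and h: "h = arsinh (q_fun (d * real n / \<mu>)) / real n"
  shows "1 / sinh (pi * d / h) \<le>
     2 * exp (- pi * \<mu> * (p_fun (d / \<mu>) - q_fun (d / \<mu>))) / (1 - exp (- 2 * pi * \<mu> * p_fun (d / \<mu>))) *
     exp (- pi * \<mu> * q_fun (d * real n / \<mu>))"
proof -
  define t t1 where "t = d * real n / \<mu>" and "t1 = d / \<mu>"
  have t1: "0 < t1" "t1 \<le> t" using pos by (auto simp: t_def t1_def field_simps)
  have t: "0 < t" using t1 by simp
  have A: "0 < arsinh (q_fun t)" using q_fun_pos[OF t] by simp
  have z: "pi * d / h = pi * \<mu> * p_fun t"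
    using A pos by (simp add: h p_fun_def q_fun_def t_def)
  have p0: "0 < p_fun t1" using t1 by (simp add: p_fun_def)
  let ?z = "pi * \<mu> * p_fun t" and ?z1 = "pi * \<mu> * p_fun t1"
  have z1: "0 < ?z1" using p0 pos by simp
  have zz: "?z1 \<le> ?z" using p_fun_mono[OF t1] pos by simp
  have "1 / sinh ?z = 2 * (exp (- ?z) / (1 - exp (- 2 * ?z)))"
  proof -
    have "sinh ?z = exp ?z * (1 - exp (- 2 * ?z)) / 2"
      by (simp add: sinh_field_def right_diff_distrib flip: exp_add)
    moreover have "1 / (c * D / 2) = 2 * (inverse c / D)" for c D :: real by (simp add: divide_simps)
    ultimately show ?thesis unfolding exp_minus[of ?z] by (simp only:)
  qed
  also have "exp (- ?z) / (1 - exp (- 2 * ?z)) \<le> exp (- ?z) / (1 - exp (- 2 * ?z1))"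
  proof (intro divide_left_mono mult_pos_pos)
    have "0 < ?z" using zz z1 by linarith
    then show "0 < 1 - exp (- 2 * ?z)" by simp
  qed (use zz z1 in auto)
  also have "\<dots> \<le> exp (- (pi * \<mu> * (p_fun t1 - q_fun t1)) - pi * \<mu> * q_fun t) / (1 - exp (- 2 * ?z1))"
  proof (rule divide_right_mono)
    have "pi * \<mu> * (p_fun t1 - q_fun t1) \<le> pi * \<mu> * (p_fun t - q_fun t)"
      using p_fun_minus_q_fun_mono[OF t1] pos by (intro mult_left_mono) auto
    then show "exp (- ?z) \<le> exp (- (pi * \<mu> * (p_fun t1 - q_fun t1)) - pi * \<mu> * q_fun t)"
      by (simp add: algebra_simps)
  qed (use z1 in auto)
  also have "exp (- (pi * \<mu> * (p_fun t1 - q_fun t1)) - pi * \<mu> * q_fun t) =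
      exp (- pi * \<mu> * (p_fun t1 - q_fun t1)) * exp (- pi * \<mu> * q_fun t)"
    by (simp add: mult_exp_exp)
  finally show ?thesis unfolding z[symmetric] t_def[symmetric] t1_def[symmetric]
    by (simp add: mult_ac)
qed

section \<open>The error bound\<close>

theorem theorem2p2:
  fixes L R \<alpha> \<beta> d \<mu> h :: real and F :: "complex \<Rightarrow> complex" and n :: nat and M N :: int
  assumes "L > 0" and "R > 0" and "\<alpha> > 0" and "\<beta> > 0"
    and "0 < d" and "d < pi / 2"
    and "F \<in> LDE L R \<alpha> \<beta> d"
    and "\<mu> = min \<alpha> \<beta>"
    and "n > 0"
    and "h = arsinh (q_fun (d * real n / \<mu>)) / real n"
    and "\<mu> = \<alpha> \<Longrightarrow>
           M = int n \<and> N = \<lceil>1 / h * arsinh (\<alpha> / \<beta> * q_fun (d * real n / \<mu>))\<rceil>"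
    and "\<mu> = \<beta> \<Longrightarrow>
           N = int n \<and> M = \<lceil>1 / h * arsinh (\<beta> / \<alpha> * q_fun (d * real n / \<mu>))\<rceil>"
  shows "(SUP x::real. ereal (norm (F (complex_of_real x) -
             (\<Sum>k\<in>{-M..N}. F (complex_of_real (of_int k * h)) *
                complex_of_real (nsinc ((x - of_int k * h) / h))))))
         \<le> ereal (DE_const L R \<alpha> \<beta> d *
                  exp (- pi * d * real n / arsinh (d * real n / \<mu>)))"
proof -
  define q where "q = q_fun (d * real n / \<mu>)"
  define E where "E = exp (- pi * \<mu> * q)"
  have \<mu>: "0 < \<mu>" "\<mu> \<le> \<alpha>" "\<mu> \<le> \<beta>" "\<mu> = \<alpha> \<or> \<mu> = \<beta>" using assms by auto
  have t: "0 < d * real n / \<mu>" using assms \<mu> by simp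
  have q: "0 < q" unfolding q_def by (rule q_fun_pos[OF t])
  have h0: "0 < h" using q assms by (simp add: q_def)
  have nh: "sinh (real n * h) = q" using assms by (simp add: q_def)
  have E: "exp (- pi * d * real n / arsinh (d * real n / \<mu>)) = E"
    using \<mu> by (simp add: E_def q_def q_fun_def)
  \<comment> \<open>the rounded node number reaches the point where the exponential has dropped to \<open>E\<close>\<close>
  have ceil: "0 \<le> c \<and> \<mu> / \<gamma> * q \<le> sinh (of_int c * h)"
    if c: "c = \<lceil>1 / h * arsinh (\<mu> / \<gamma> * q)\<rceil>" and \<gamma>: "\<mu> \<le> \<gamma>" for c \<gamma>
  proof -
    have p: "0 < arsinh (\<mu> / \<gamma> * q)" using \<mu> \<gamma> q by simp
    have "1 / h * arsinh (\<mu> / \<gamma> * q) \<le> of_int c" unfolding c by (rule le_of_int_ceiling)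
    then have le: "arsinh (\<mu> / \<gamma> * q) \<le> of_int c * h" using h0 by (simp add: field_simps)
    have "0 < of_int c * h" using p le by (rule order.strict_trans2)
    then have "0 \<le> c" using h0 by (simp add: zero_less_mult_iff)
    moreover have "\<mu> / \<gamma> * q \<le> sinh (of_int c * h)"
      using le sinh_real_le_iff[of "arsinh (\<mu> / \<gamma> * q)" "of_int c * h"] by simp
    ultimately show ?thesis by simp
  qed
  have MN: "0 \<le> M" "0 \<le> N" "\<mu> / \<alpha> * q \<le> sinh (of_int M * h)" "\<mu> / \<beta> * q \<le> sinh (of_int N * h)"
  proof -
    have "0 \<le> M \<and> 0 \<le> N \<and> \<mu> / \<alpha> * q \<le> sinh (of_int M * h) \<and> \<mu> / \<beta> * q \<le> sinh (of_int N * h)"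
      using \<mu>(4)
    proof
      assume m: "\<mu> = \<alpha>"
      then have "M = int n" "N = \<lceil>1 / h * arsinh (\<mu> / \<beta> * q)\<rceil>" using assms(11) by (auto simp: q_def)
      then show ?thesis using ceil[of N \<beta>] \<mu> nh m by simp
    next
      assume m: "\<mu> = \<beta>"
      then have "N = int n" "M = \<lceil>1 / h * arsinh (\<mu> / \<alpha> * q)\<rceil>" using assms(12) by (auto simp: q_def)
      then show ?thesis using ceil[of M \<alpha>] \<mu> nh m by simp
    qed
    then show "0 \<le> M" "0 \<le> N" "\<mu> / \<alpha> * q \<le> sinh (of_int M * h)" "\<mu> / \<beta> * q \<le> sinh (of_int N * h)" by auto
  qed
  have Fholo: "F holomorphic_on strip d" using assms(7) by (auto simp: LDE_def intro: analytic_imp_holomorphic)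
  define K where "K a = L / cos (pi / 2 * sin a) powr (\<alpha> + \<beta>)" for a
  define B where "B a = 2 * K a / (pi * (pi * \<mu> * cos a) * a * sinh (pi * a / h))" for a
  show ?thesis
  proof (rule SUP_least)
    fix x :: real
    define S where "S k = F (complex_of_real (of_int k * h)) * complex_of_real (nsinc ((x - of_int k * h) / h))" for k :: int
    define e where "e = norm (F (complex_of_real x) - (\<Sum>k\<in>{-M..N}. S k))"
    \<comment> \<open>fixed height \<open>a\<close>; the vertical sides move to infinity\<close>
    have bound_a: "e \<le> B a + R * E / d" if a: "0 < a" "a < d" for a
    proof (rule LIMSEQ_le_const)
      have "filterlim (\<lambda>m. pi * ((real m + 1/2) * h - \<bar>x\<bar>)) at_top sequentially"
        using h0 by real_asymp
      then have "(\<lambda>m. 2 * K a * a / (pi * ((real m + 1/2) * h - \<bar>x\<bar>))) \<longlonglongrightarrow> 0"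
        by (intro tendsto_divide_0[OF tendsto_const] filterlim_at_top_imp_at_infinity)
      then have "(\<lambda>m. B a + 2 * K a * a / (pi * ((real m + 1/2) * h - \<bar>x\<bar>)) + R * E / d) \<longlonglongrightarrow> B a + 0 + R * E / d"
        by (intro tendsto_intros)
      then show "(\<lambda>m. B a + 2 * K a * a / (pi * ((real m + 1/2) * h - \<bar>x\<bar>)) + R * E / d) \<longlonglongrightarrow> B a + R * E / d" by simp
      have "\<forall>\<^sub>F m in sequentially. \<bar>x\<bar> / h < real m \<and> real_of_int (max M N) \<le> real m"
        by (intro eventually_conj) real_asymp+
      then obtain m0 where m0: "\<And>m. m \<ge> m0 \<Longrightarrow> \<bar>x\<bar> / h < real m \<and> real_of_int (max M N) \<le> real m"
        by (auto simp: eventually_sequentially)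
      show "\<exists>m0. \<forall>m\<ge>m0. e \<le> B a + 2 * K a * a / (pi * ((real m + 1/2) * h - \<bar>x\<bar>)) + R * E / d"
      proof (intro exI[of _ m0] allI impI)
        fix m assume "m \<ge> m0"
        note m = m0[OF this]
        have mi: "M \<le> int m" "N \<le> int m" using m by linarith+
        have "\<bar>x\<bar> < real m * h" using m h0 by (simp add: field_simps)
        then have x: "\<bar>x\<bar> < (real m + 1/2) * h" using h0 by (simp add: algebra_simps)
        have cos_a: "0 < cos a" using a assms(6) by (intro cos_gt_zero_pi) auto
        have "norm (F (complex_of_real x) - (\<Sum>k\<in>{- int m..int m}. S k)) \<le>
           2 * K a / (pi * (pi * \<mu> * cos a) * a * sinh (pi * a / h)) + 2 * K a * a / (pi * ((real m + 1/2) * h - \<bar>x\<bar>))"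
          unfolding S_def
        proof (rule norm_sinc_rectangle_error[OF Fholo a h0 refl x])
          show "0 \<le> K a" using assms by (simp add: K_def)
          show "0 < pi * \<mu> * cos a" using \<mu> cos_a by simp
          show "norm (F (Complex s y)) \<le> K a * exp (- (pi * \<mu> * cos a) * \<bar>sinh s\<bar>)" if "\<bar>y\<bar> \<le> a" for s y
            using LDE_bound_strip[OF assms(7,1,3,4) a assms(6) that] unfolding K_def assms(8) .
        qed
        moreover have "norm ((\<Sum>k\<in>{- int m..int m}. S k) - (\<Sum>k\<in>{-M..N}. S k)) \<le> R * (E / (2 * d)) + R * (E / (2 * d))"
        proof -
          have "norm ((\<Sum>k\<in>{- int m..int m}. S k) - (\<Sum>k\<in>{-M..N}. S k)) \<le>
             R * (exp (- (pi * \<alpha>) * sinh (of_int M * h)) / (pi * \<alpha> * h * cosh (of_int M * h))) +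
             R * (exp (- (pi * \<beta>) * sinh (of_int N * h)) / (pi * \<beta> * h * cosh (of_int N * h)))"
            unfolding S_def using LDE_bound_real[OF assms(7,2,3,4)]
            by (intro norm_sinc_truncation_le h0 assms(2,3,4) MN(1,2) mi) auto
          also have "\<dots> \<le> R * (E / (2 * d)) + R * (E / (2 * d))"
            unfolding E_def q_def using MN(3,4) assms \<mu>
            by (intro add_mono mult_left_mono tail_coefficient_le) (auto simp: q_def)
          finally show ?thesis .
        qed
        moreover have "R * (E / (2 * d)) + R * (E / (2 * d)) = R * E / d" by simp
        moreover have tri: "norm (F (complex_of_real x) - (\<Sum>k\<in>{-M..N}. S k)) \<le>
            norm (F (complex_of_real x) - (\<Sum>k\<in>{- int m..int m}. S k)) +
            norm ((\<Sum>k\<in>{- int m..int m}. S k) - (\<Sum>k\<in>{-M..N}. S k))"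
          using norm_triangle_ineq[of "F (complex_of_real x) - (\<Sum>k\<in>{- int m..int m}. S k)"
            "(\<Sum>k\<in>{- int m..int m}. S k) - (\<Sum>k\<in>{-M..N}. S k)"] by simp
        ultimately show "e \<le> B a + 2 * K a * a / (pi * ((real m + 1/2) * h - \<bar>x\<bar>)) + R * E / d"
          unfolding e_def B_def
          using tri by linarith
      qed
    qed
    have cos_d: "0 < cos d" using assms by (intro cos_gt_zero_pi) auto
    have sin_d: "0 \<le> sin d" "sin d < 1"
      using assms(5,6) sin_monotone_2pi[of d "pi/2"] by (auto intro!: sin_ge_zero)
    have K_cos: "0 < cos (pi / 2 * sin d)"
      by (intro cos_gt_zero_pi) (use sin_d in \<open>auto intro: order.strict_trans2[of _ 0]\<close>)
    have sinh_d: "0 < sinh (pi * d / h)" using h0 assms(5) by simp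
    \<comment> \<open>the height tends to \<open>d\<close>, where the bound is continuous\<close>
    have "e \<le> B d + R * E / d"
    proof (rule tendsto_lowerbound)
      show "((\<lambda>a. B a + R * E / d) \<longlongrightarrow> B d + R * E / d) (at_left d)"
        unfolding B_def K_def using cos_d K_cos sinh_d assms(5) \<mu>(1) h0
        by (intro tendsto_intros) auto
      have "\<forall>\<^sub>F a in at_left d. a \<in> {0<..<d}" using assms(5) by (rule eventually_at_left_real)
      then show "\<forall>\<^sub>F a in at_left d. e \<le> B a + R * E / d"
        by eventually_elim (use bound_a in auto)
    qed simp
    also have "B d = 2 * K d / (pi * (pi * \<mu> * cos d) * d) * (1 / sinh (pi * d / h))" by (simp add: B_def)
    also have "\<dots> \<le> 2 * K d / (pi * (pi * \<mu> * cos d) * d) * (2 * exp (- pi * \<mu> * (p_fun (d / \<mu>) - q_fun (d / \<mu>))) / (1 - exp (- 2 * pi * \<mu> * p_fun (d / \<mu>))) * E)"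
      unfolding E_def q_def using assms \<mu> cos_d
      by (intro mult_left_mono inverse_sinh_le_rate) (auto simp: K_def)
    also have "\<dots> + R * E / d = DE_const L R \<alpha> \<beta> d * E"
    proof -
      have "2 * (L / k) / (pi * (pi * \<mu> * c) * d) * (2 * v / w * E) + R * E / d =
          2 / (pi * d) * (2 * L * v / (pi * \<mu> * w * k * c) + pi / 2 * R) * E" for k c v w :: real
      proof -
        have "2 / (pi * d) * (pi / 2 * R) * E = R * E / d" by simp
        moreover have "2 * (L / k) / (pi * (pi * \<mu> * c) * d) * (2 * v / w * E) =
            2 / (pi * d) * (2 * L * v / (pi * \<mu> * w * k * c)) * E"
          by (simp add: divide_inverse mult_ac)
        ultimately show ?thesis by (simp only: distrib_left distrib_right)
      qed
      then show ?thesis unfolding DE_const_def Let_def assms(8)[symmetric] K_def .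
    qed
    finally show "ereal (norm (F (complex_of_real x) - (\<Sum>k\<in>{-M..N}. F (complex_of_real (of_int k * h)) *
                complex_of_real (nsinc ((x - of_int k * h) / h)))))
         \<le> ereal (DE_const L R \<alpha> \<beta> d * exp (- pi * d * real n / arsinh (d * real n / \<mu>)))"
      unfolding E e_def S_def by simp
  qed
qed

end
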